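(* Let $\mathcal K$ be either the category $\mathsf{Cat}$ of categories or the category $\mathsf{Grpd}$ of groupoids. One obtains a model structure on $\mathcal K$ by taking weak equivalences to be equivalences of categories, fibrations to be iso-fibrations, and cofibrations to be normally cloven iso-cofibrations.
   Context: $1$ is the category with one object and one arrow. $\mathcal I$ is the free groupoid on the directed graph $0\to 1$; $i_0,i_1:1\to\mathcal I$ are the functors picking out $0$ and $1$, and for a category $A$ we also write $i_0(A),i_1(A):A\to A\times\mathcal I$ for $A\times i_0,A\times i_1$ and $p(A):A\times\mathcal I\to A$ for the projection. Iso-fibration: a functor $F:A_0\to A_1$ such that for every $a:1\to A_0$ and $g:\mathcal I\to A_1$ with $g\circ i_0=F\circ a$ there is $l:\mathcal I\to A_0$ with $l\circ i_0=a$ and $F\circ l=g$. Normally cloven iso-cofibration: a functor $j:A_0\to A_1$ in $\mathcal K$ for which one can choose, for every object $A_2$ of $\mathcal K$ and all functors $g:A_1\to A_2$, $h:A_0\times\mathcal I\to A_2$ with $h\circ i_0(A_0)=g\circ j$, a functor $k_{A_2}(g,h):A_1\times\mathcal I\to A_2$ with $k_{A_2}(g,h)\circ(j\times\mathcal I)=h$ and $k_{A_2}(g,h)\circ i_0(A_1)=g$, such that (i) $k_{A_2}(g,g\circ j\circ p(A_0))=g\circ p(A_1)$, and (ii) $g'\circ k_{A_2}(g,h)=k_{A_3}(g'\circ g,g'\circ h)$ for every functor $g':A_2\to A_3$ in $\mathcal K$. A model structure means a (closed) model structure in the sense of Quillen: two-out-of-three for weak equivalences; (trivial) fibrations are exactly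 the arrows with the right lifting property with respect to trivial cofibrations (resp. cofibrations); (trivial) cofibrations are exactly the arrows with the left lifting property with respect to trivial fibrations (resp. fibrations); both factorisations exist (not required functorial). *)

theory Defs
  imports Main "HOL-Library.FuncSet"
begin

text \<open>
  Only the values of the structure maps on objects, arrows and composable pairs matter;
  \<open>Cmp A g f\<close> is the composite of \<open>f\<close> followed by \<open>g\<close>.
\<close>

record ('o, 'm) cat =
  Obj :: "'o set"
  Arr :: "'m set"
  Dom :: "'m \<Rightarrow> 'o"
  Cod :: "'m \<Rightarrow> 'o"
  Idn :: "'o \<Rightarrow> 'm"
  Cmp :: "'m \<Rightarrow> 'm \<Rightarrow> 'm"

definition category :: "('o, 'm) cat \<Rightarrow> bool" where
  "category A \<longleftrightarrow>
     (\<forall>f\<in>Arr A. Dom A f \<in> Obj A \<and> Cod A f \<in> Obj A) \<and>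
     (\<forall>a\<in>Obj A. Idn A a \<in> Arr A \<and> Dom A (Idn A a) = a \<and> Cod A (Idn A a) = a) \<and>
     (\<forall>f\<in>Arr A. \<forall>g\<in>Arr A. Cod A f = Dom A g \<longrightarrow>
        Cmp A g f \<in> Arr A \<and> Dom A (Cmp A g f) = Dom A f \<and> Cod A (Cmp A g f) = Cod A g) \<and>
     (\<forall>f\<in>Arr A. Cmp A f (Idn A (Dom A f)) = f \<and> Cmp A (Idn A (Cod A f)) f = f) \<and>
     (\<forall>f\<in>Arr A. \<forall>g\<in>Arr A. \<forall>h\<in>Arr A. Cod A f = Dom A g \<longrightarrow> Cod A g = Dom A h \<longrightarrow>
        Cmp A h (Cmp A g f) = Cmp A (Cmp A h g) f)"

definition iso :: "('o, 'm) cat \<Rightarrow> 'm \<Rightarrow> bool" where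
  "iso A f \<longleftrightarrow> f \<in> Arr A \<and>
     (\<exists>g\<in>Arr A. Dom A g = Cod A f \<and> Cod A g = Dom A f \<and>
        Cmp A g f = Idn A (Dom A f) \<and> Cmp A f g = Idn A (Cod A f))"

definition groupoid :: "('o, 'm) cat \<Rightarrow> bool" where
  "groupoid A \<longleftrightarrow> category A \<and> (\<forall>f\<in>Arr A. iso A f)"

record ('o, 'm, 'p, 'n) func =
  FDom :: "('o, 'm) cat"
  FCod :: "('p, 'n) cat"
  FObj :: "'o \<Rightarrow> 'p"
  FArr :: "'m \<Rightarrow> 'n"

text \<open>
  The two underlying maps are required to be extensional (undefined off the domain), so that
  equality of functors is equality in HOL.
\<close>

definition is_functor ::
    "('o, 'm, 'p, 'n) func \<Rightarrow> ('o, 'm) cat \<Rightarrow> ('p, 'n) cat \<Rightarrow> bool" where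
  "is_functor F A B \<longleftrightarrow> category A \<and> category B \<and> FDom F = A \<and> FCod F = B \<and>
     FObj F \<in> Obj A \<rightarrow>\<^sub>E Obj B \<and> FArr F \<in> Arr A \<rightarrow>\<^sub>E Arr B \<and>
     (\<forall>f\<in>Arr A. Dom B (FArr F f) = FObj F (Dom A f) \<and> Cod B (FArr F f) = FObj F (Cod A f)) \<and>
     (\<forall>a\<in>Obj A. FArr F (Idn A a) = Idn B (FObj F a)) \<and>
     (\<forall>f\<in>Arr A. \<forall>g\<in>Arr A. Cod A f = Dom A g \<longrightarrow>
        FArr F (Cmp A g f) = Cmp B (FArr F g) (FArr F f))"

definition id_functor :: "('o, 'm) cat \<Rightarrow> ('o, 'm, 'o, 'm) func" where
  "id_functor A = \<lparr>FDom = A, FCod = A, FObj = (\<lambda>a\<in>Obj A. a), FArr = (\<lambda>f\<in>Arr A. f)\<rparr>"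

definition comp_functor ::
    "('p, 'n, 'q, 'r) func \<Rightarrow> ('o, 'm, 'p, 'n) func \<Rightarrow> ('o, 'm, 'q, 'r) func"
    (infixl "\<circ>\<^sub>F" 55) where
  "G \<circ>\<^sub>F F = \<lparr>FDom = FDom F, FCod = FCod G,
     FObj = (\<lambda>a\<in>Obj (FDom F). FObj G (FObj F a)),
     FArr = (\<lambda>f\<in>Arr (FDom F). FArr G (FArr F f))\<rparr>"

definition nat_iso ::
    "('o, 'm, 'p, 'n) func \<Rightarrow> ('o, 'm, 'p, 'n) func \<Rightarrow> ('o \<Rightarrow> 'n) \<Rightarrow> bool" where
  "nat_iso F G t \<longleftrightarrow> FDom F = FDom G \<and> FCod F = FCod G \<and>
     (\<forall>a\<in>Obj (FDom F). iso (FCod F) (t a) \<and>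
        Dom (FCod F) (t a) = FObj F a \<and> Cod (FCod F) (t a) = FObj G a) \<and>
     (\<forall>f\<in>Arr (FDom F).
        Cmp (FCod F) (t (Cod (FDom F) f)) (FArr F f) =
        Cmp (FCod F) (FArr G f) (t (Dom (FDom F) f)))"

definition equivalence :: "('o, 'm, 'p, 'n) func \<Rightarrow> bool" where
  "equivalence F \<longleftrightarrow> is_functor F (FDom F) (FCod F) \<and>
     (\<exists>G s t. is_functor G (FCod F) (FDom F) \<and>
        nat_iso (G \<circ>\<^sub>F F) (id_functor (FDom F)) s \<and>
        nat_iso (F \<circ>\<^sub>F G) (id_functor (FCod F)) t)"

definition one_cat :: "(unit, unit) cat" where
  "one_cat = \<lparr>Obj = UNIV, Arr = UNIV, Dom = (\<lambda>_. ()), Cod = (\<lambda>_. ()),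
     Idn = (\<lambda>_. ()), Cmp = (\<lambda>_ _. ())\<rparr>"

text \<open>
  The free groupoid on the graph \<open>0 \<rightarrow> 1\<close>, with \<open>0 = False\<close> and \<open>1 = True\<close>; the pair
  \<open>(x, y)\<close> is the unique arrow from \<open>x\<close> to \<open>y\<close>. Its universal property is the lemma
  \<open>interval_free\<close> below.
\<close>

definition interval :: "(bool, bool \<times> bool) cat" where
  "interval = \<lparr>Obj = UNIV, Arr = UNIV, Dom = fst, Cod = snd,
     Idn = (\<lambda>x. (x, x)), Cmp = (\<lambda>g f. (fst f, snd g))\<rparr>"

lemma groupoid_interval: "groupoid interval"
  by (auto simp: groupoid_def category_def iso_def interval_def)

lemma interval_free:
  assumes G: "groupoid G" and f: "f \<in> Arr G"
  shows "\<exists>!F. is_functor F interval G \<and> FArr F (False, True) = f"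
proof -
  have cat: "category G" using G by (simp add: groupoid_def)
  have "iso G f" using G f by (simp add: groupoid_def)
  then obtain g where g: "g \<in> Arr G" "Dom G g = Cod G f" "Cod G g = Dom G f"
    "Cmp G g f = Idn G (Dom G f)" "Cmp G f g = Idn G (Cod G f)"
    by (auto simp: iso_def)
  have ob: "Dom G f \<in> Obj G" "Cod G f \<in> Obj G"
    using cat f by (simp_all add: category_def)
  have unit: "\<And>h. h \<in> Arr G \<Longrightarrow> Cmp G h (Idn G (Dom G h)) = h \<and> Cmp G (Idn G (Cod G h)) h = h"
    and ids: "\<And>a. a \<in> Obj G \<Longrightarrow> Idn G a \<in> Arr G \<and> Dom G (Idn G a) = a \<and> Cod G (Idn G a) = a"
    and assoc: "\<And>h k l. h \<in> Arr G \<Longrightarrow> k \<in> Arr G \<Longrightarrow> l \<in> Arr G \<Longrightarrow> Cod G h = Dom G k \<Longrightarrow>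
      Cod G k = Dom G l \<Longrightarrow> Cmp G l (Cmp G k h) = Cmp G (Cmp G l k) h"
    using cat by (simp_all add: category_def)
  have idid: "Cmp G (Idn G a) (Idn G a) = Idn G a" if "a \<in> Obj G" for a
    using unit[of "Idn G a"] ids[OF that] by simp
  define F where "F = \<lparr>FDom = interval, FCod = G,
    FObj = (\<lambda>x. if x then Cod G f else Dom G f),
    FArr = (\<lambda>p. if fst p then (if snd p then Idn G (Cod G f) else g)
                 else (if snd p then f else Idn G (Dom G f)))\<rparr>"
  have "category interval" using groupoid_interval by (simp add: groupoid_def)
  then have F: "is_functor F interval G"
    using cat f g ob ids idid unit[OF f] unit[OF g(1)]
    by (auto simp: is_functor_def F_def interval_def PiE_def extensional_def)
  show ?thesis
  proof (rule ex1I[of _ F])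
    show "is_functor F interval G \<and> FArr F (False, True) = f"
      using F by (simp add: F_def)
  next
    fix H assume H: "is_functor H interval G \<and> FArr H (False, True) = f"
    then have dom: "FDom H = interval" "FCod H = G"
      and Harr: "\<And>p. FArr H p \<in> Arr G"
      and Hdc: "\<And>p. Dom G (FArr H p) = FObj H (fst p) \<and> Cod G (FArr H p) = FObj H (snd p)"
      and Hid: "\<And>x. FArr H (x, x) = Idn G (FObj H x)"
      and Hc: "\<And>p q. snd p = fst q \<Longrightarrow>
        FArr H (fst p, snd q) = Cmp G (FArr H q) (FArr H p)"
      by (auto simp: is_functor_def interval_def)
    have Hf: "FArr H (False, True) = f" using H by simp
    have o: "FObj H False = Dom G f" "FObj H True = Cod G f"
      using Hdc[of "(False, True)"] Hf by auto
    let ?h = "FArr H (True, False)"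
    have h: "Cmp G ?h f = Idn G (Dom G f)" "Dom G ?h = Cod G f" "Cod G ?h = Dom G f"
      using Hc[of "(False, True)" "(True, False)"] Hf Hid[of False] o Hdc[of "(True, False)"]
      by auto
    have "?h = Cmp G ?h (Cmp G f g)"
      using unit[OF Harr[of "(True, False)"]] h g by simp
    also have "\<dots> = Cmp G (Cmp G ?h f) g"
      using assoc[OF g(1) f Harr[of "(True, False)"]] h g by simp
    also have "\<dots> = g" using h unit[OF g(1)] g by simp
    finally have hg: "?h = g" .
    have "FObj H = FObj F" using o by (auto simp: F_def fun_eq_iff)
    moreover have "FArr H p = FArr F p" for p
      using hg Hf Hid o by (cases p) (auto simp: F_def)
    ultimately show "H = F"
      using dom by (auto simp: F_def fun_eq_iff intro!: func.equality)
  qed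
qed

definition end0 :: "(unit, unit, bool, bool \<times> bool) func" where
  "end0 = \<lparr>FDom = one_cat, FCod = interval,
     FObj = (\<lambda>_. False), FArr = (\<lambda>_. (False, False))\<rparr>"

definition prod_cat :: "('o, 'm) cat \<Rightarrow> ('p, 'n) cat \<Rightarrow> ('o \<times> 'p, 'm \<times> 'n) cat"
    (infixr "\<times>\<^sub>C" 80) where
  "A \<times>\<^sub>C B = \<lparr>Obj = Obj A \<times> Obj B, Arr = Arr A \<times> Arr B,
     Dom = map_prod (Dom A) (Dom B), Cod = map_prod (Cod A) (Cod B),
     Idn = map_prod (Idn A) (Idn B),
     Cmp = (\<lambda>g f. (Cmp A (fst g) (fst f), Cmp B (snd g) (snd f)))\<rparr>"

definition prod_functor ::
    "('o, 'm, 'p, 'n) func \<Rightarrow> ('o2, 'm2, 'p2, 'n2) func \<Rightarrow>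
     ('o \<times> 'o2, 'm \<times> 'm2, 'p \<times> 'p2, 'n \<times> 'n2) func"
    (infixr "\<times>\<^sub>F" 80) where
  "F \<times>\<^sub>F G = \<lparr>FDom = FDom F \<times>\<^sub>C FDom G, FCod = FCod F \<times>\<^sub>C FCod G,
     FObj = (\<lambda>x\<in>Obj (FDom F \<times>\<^sub>C FDom G). map_prod (FObj F) (FObj G) x),
     FArr = (\<lambda>x\<in>Arr (FDom F \<times>\<^sub>C FDom G). map_prod (FArr F) (FArr G) x)\<rparr>"

text \<open>\<open>cyl0 A\<close> is \<open>A \<times>\<^sub>F end0\<close> after identifying \<open>A\<close> with \<open>A \<times>\<^sub>C one_cat\<close>.\<close>

definition cyl0 :: "('o, 'm) cat \<Rightarrow> ('o, 'm, 'o \<times> bool, 'm \<times> (bool \<times> bool)) func" where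
  "cyl0 A = \<lparr>FDom = A, FCod = A \<times>\<^sub>C interval,
     FObj = (\<lambda>a\<in>Obj A. (a, FObj end0 ())), FArr = (\<lambda>f\<in>Arr A. (f, FArr end0 ()))\<rparr>"

definition cyl_proj :: "('o, 'm) cat \<Rightarrow> ('o \<times> bool, 'm \<times> (bool \<times> bool), 'o, 'm) func" where
  "cyl_proj A = \<lparr>FDom = A \<times>\<^sub>C interval, FCod = A,
     FObj = (\<lambda>x\<in>Obj (A \<times>\<^sub>C interval). fst x), FArr = (\<lambda>x\<in>Arr (A \<times>\<^sub>C interval). fst x)\<rparr>"

text \<open>
  Smallness is relative to an infinite cardinal \<open>\<kappa>\<close>: the objects and the arrows are elements
  of a fixed infinite type \<open>'u\<close>, and there are fewer than \<open>\<kappa>\<close> of each. With \<open>\<kappa>\<close> the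
  cardinality of a Grothendieck universe embedded in \<open>'u\<close> this is the usual notion of small category, and if
  \<open>\<kappa>\<close> exceeds the cardinality of \<open>'u\<close> it is no restriction on categories carried by \<open>'u\<close>.
\<close>

type_synonym 'u smallcat = "('u, 'u) cat"
type_synonym 'u smallfunc = "('u, 'u, 'u, 'u) func"

definition small :: "'k rel \<Rightarrow> 'u smallcat \<Rightarrow> bool" where
  "small \<kappa> A \<longleftrightarrow> (card_of (Obj A), \<kappa>) \<in> ordLess \<and> (card_of (Arr A), \<kappa>) \<in> ordLess"

definition functor_category :: "'u smallcat set \<Rightarrow> ('u smallcat, 'u smallfunc) cat" where
  "functor_category S = \<lparr>Obj = S, Arr = {F. \<exists>A\<in>S. \<exists>B\<in>S. is_functor F A B},
     Dom = FDom, Cod = FCod, Idn = id_functor, Cmp = (\<circ>\<^sub>F)\<rparr>"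

definition Cat :: "'k rel \<Rightarrow> ('u smallcat, 'u smallfunc) cat" where
  "Cat \<kappa> = functor_category {A. category A \<and> small \<kappa> A}"

definition Grpd :: "'k rel \<Rightarrow> ('u smallcat, 'u smallfunc) cat" where
  "Grpd \<kappa> = functor_category {A. groupoid A \<and> small \<kappa> A}"

definition iso_fibration :: "('o, 'm, 'p, 'n) func \<Rightarrow> bool" where
  "iso_fibration F \<longleftrightarrow> is_functor F (FDom F) (FCod F) \<and>
     (\<forall>a g. is_functor a one_cat (FDom F) \<longrightarrow> is_functor g interval (FCod F) \<longrightarrow>
        g \<circ>\<^sub>F end0 = F \<circ>\<^sub>F a \<longrightarrow>
        (\<exists>l. is_functor l interval (FDom F) \<and> l \<circ>\<^sub>F end0 = a \<and> F \<circ>\<^sub>F l = g))"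

definition extension_problem ::
    "'u smallfunc \<Rightarrow> 'u smallcat \<Rightarrow> 'u smallfunc \<Rightarrow>
     ('u \<times> bool, 'u \<times> (bool \<times> bool), 'u, 'u) func \<Rightarrow> bool" where
  "extension_problem j X g h \<longleftrightarrow> is_functor g (FCod j) X \<and>
     is_functor h (FDom j \<times>\<^sub>C interval) X \<and> h \<circ>\<^sub>F cyl0 (FDom j) = g \<circ>\<^sub>F j"

definition normally_cloven_iso_cofibration ::
    "('u smallcat, 'u smallfunc) cat \<Rightarrow> 'u smallfunc \<Rightarrow> bool" where
  "normally_cloven_iso_cofibration K j \<longleftrightarrow> j \<in> Arr K \<and>
     (\<exists>k :: 'u smallcat \<Rightarrow> 'u smallfunc \<Rightarrow>
            ('u \<times> bool, 'u \<times> (bool \<times> bool), 'u, 'u) func \<Rightarrow>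
            ('u \<times> bool, 'u \<times> (bool \<times> bool), 'u, 'u) func.
        (\<forall>X\<in>Obj K. \<forall>g h. extension_problem j X g h \<longrightarrow>
           is_functor (k X g h) (FCod j \<times>\<^sub>C interval) X \<and>
           k X g h \<circ>\<^sub>F (j \<times>\<^sub>F id_functor interval) = h \<and>
           k X g h \<circ>\<^sub>F cyl0 (FCod j) = g) \<and>
        (\<forall>X\<in>Obj K. \<forall>g. is_functor g (FCod j) X \<longrightarrow>
           k X g (g \<circ>\<^sub>F j \<circ>\<^sub>F cyl_proj (FDom j)) = g \<circ>\<^sub>F cyl_proj (FCod j)) \<and>
        (\<forall>X\<in>Obj K. \<forall>Y\<in>Obj K. \<forall>g h g'. extension_problem j X g h \<longrightarrow> is_functor g' X Y \<longrightarrow>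
           g' \<circ>\<^sub>F k X g h = k Y (g' \<circ>\<^sub>F g) (g' \<circ>\<^sub>F h)))"

definition lifts :: "('o, 'm) cat \<Rightarrow> 'm \<Rightarrow> 'm \<Rightarrow> bool" where
  "lifts K i p \<longleftrightarrow> (\<forall>u\<in>Arr K. \<forall>v\<in>Arr K.
     Dom K u = Dom K i \<longrightarrow> Cod K u = Dom K p \<longrightarrow>
     Dom K v = Cod K i \<longrightarrow> Cod K v = Cod K p \<longrightarrow> Cmp K p u = Cmp K v i \<longrightarrow>
     (\<exists>l\<in>Arr K. Dom K l = Cod K i \<and> Cod K l = Dom K p \<and> Cmp K l i = u \<and> Cmp K p l = v))"

definition rlp :: "('o, 'm) cat \<Rightarrow> 'm set \<Rightarrow> 'm set" where
  "rlp K S = {p \<in> Arr K. \<forall>i\<in>S. lifts K i p}"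

definition llp :: "('o, 'm) cat \<Rightarrow> 'm set \<Rightarrow> 'm set" where
  "llp K S = {i \<in> Arr K. \<forall>p\<in>S. lifts K i p}"

definition two_out_of_three :: "('o, 'm) cat \<Rightarrow> 'm set \<Rightarrow> bool" where
  "two_out_of_three K W \<longleftrightarrow> (\<forall>f\<in>Arr K. \<forall>g\<in>Arr K. Cod K f = Dom K g \<longrightarrow>
     (f \<in> W \<and> g \<in> W \<longrightarrow> Cmp K g f \<in> W) \<and>
     (f \<in> W \<and> Cmp K g f \<in> W \<longrightarrow> g \<in> W) \<and>
     (g \<in> W \<and> Cmp K g f \<in> W \<longrightarrow> f \<in> W))"

definition factorises :: "('o, 'm) cat \<Rightarrow> 'm set \<Rightarrow> 'm set \<Rightarrow> bool" where
  "factorises K L R \<longleftrightarrow>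
     (\<forall>f\<in>Arr K. \<exists>i\<in>L. \<exists>p\<in>R. Cod K i = Dom K p \<and> Cmp K p i = f)"

definition model_structure :: "('o, 'm) cat \<Rightarrow> 'm set \<Rightarrow> 'm set \<Rightarrow> 'm set \<Rightarrow> bool" where
  "model_structure K W Fib Cof \<longleftrightarrow> category K \<and>
     W \<subseteq> Arr K \<and> Fib \<subseteq> Arr K \<and> Cof \<subseteq> Arr K \<and>
     two_out_of_three K W \<and>
     Fib = rlp K (Cof \<inter> W) \<and> Fib \<inter> W = rlp K Cof \<and>
     Cof = llp K (Fib \<inter> W) \<and> Cof \<inter> W = llp K Fib \<and>
     factorises K Cof (Fib \<inter> W) \<and> factorises K (Cof \<inter> W) Fib"

end

theory Submission
  imports Defs
begin

text \<open>
  The normally cloven iso-cofibrations turn out to be the functors that are injective on objects.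
  If \<open>j\<close> is injective on objects, a homotopy out of \<open>g \<circ> j\<close> prescribes at most one isomorphism out
  of every object \<open>g b\<close>. One fills in identities and conjugates \<open>g\<close> by the resulting family, and
  this choice is natural and normal (\<open>inj_imp_normally_cloven\<close>). Conversely, write \<open>j = p \<circ> i\<close> with
  \<open>i\<close> injective on objects and \<open>p\<close> a surjective equivalence with section \<open>s\<close>. Extending the
  isomorphism \<open>s \<circ> j \<cong> i\<close> along \<open>j\<close> shows that \<open>i\<close>, on objects, factors through \<open>j\<close>, so \<open>j\<close> is
  injective as well (\<open>normally_cloven_imp_inj\<close>).

  What remains is the canonical model structure. Equivalences are the fully faithful, essentially
  surjective functors, and trivial fibrations are the equivalences that are surjective on objects.
  Two constructions do nearly all the work. One conjugates a functor by a family of isomorphisms out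
  of its values (\<open>twist\<close>); the other lifts a functor through a fully faithful one once the lift is
  chosen on objects (\<open>ff_lift\<close>). They give both lifting properties
  (\<open>lift_against_trivial_fibration\<close>, \<open>trivial_cofibration_lift\<close>) and the functors in both
  factorisations. The middle object of each factorisation is a category obtained by pulling back
  hom-sets along a map of objects (\<open>reindexed\<close>), which preserves groupoids and, as \<open>\<kappa>\<close> is
  infinite, stays small for a small set of objects. This is why the argument is the same for categories and groupoids and for every
  \<open>\<kappa>\<close>. Finally, the four descriptions by lifting properties follow from the lifts and the
  factorisations by the retract argument.
\<close>

section \<open>Arrows, inverses and functors\<close>

lemma category_simps:
  assumes "category A"
  shows "\<And>f. f \<in> Arr A \<Longrightarrow> Dom A f \<in> Obj A" "\<And>f. f \<in> Arr A \<Longrightarrow> Cod A f \<in> Obj A"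
    "\<And>a. a \<in> Obj A \<Longrightarrow> Idn A a \<in> Arr A"
    "\<And>a. a \<in> Obj A \<Longrightarrow> Dom A (Idn A a) = a" "\<And>a. a \<in> Obj A \<Longrightarrow> Cod A (Idn A a) = a"
    "\<And>f g. f \<in> Arr A \<Longrightarrow> g \<in> Arr A \<Longrightarrow> Cod A f = Dom A g \<Longrightarrow> Cmp A g f \<in> Arr A"
    "\<And>f g. f \<in> Arr A \<Longrightarrow> g \<in> Arr A \<Longrightarrow> Cod A f = Dom A g \<Longrightarrow> Dom A (Cmp A g f) = Dom A f"
    "\<And>f g. f \<in> Arr A \<Longrightarrow> g \<in> Arr A \<Longrightarrow> Cod A f = Dom A g \<Longrightarrow> Cod A (Cmp A g f) = Cod A g"
    "\<And>f a. f \<in> Arr A \<Longrightarrow> a = Dom A f \<Longrightarrow> Cmp A f (Idn A a) = f"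
    "\<And>f a. f \<in> Arr A \<Longrightarrow> a = Cod A f \<Longrightarrow> Cmp A (Idn A a) f = f"
    "\<And>f g h. f \<in> Arr A \<Longrightarrow> g \<in> Arr A \<Longrightarrow> h \<in> Arr A \<Longrightarrow> Cod A f = Dom A g \<Longrightarrow>
      Cod A g = Dom A h \<Longrightarrow> Cmp A (Cmp A h g) f = Cmp A h (Cmp A g f)"
  using assms by (simp_all add: category_def)

definition cinv :: "('o, 'm) cat \<Rightarrow> 'm \<Rightarrow> 'm" where
  "cinv A f = (SOME g. g \<in> Arr A \<and> Dom A g = Cod A f \<and> Cod A g = Dom A f \<and>
     Cmp A g f = Idn A (Dom A f) \<and> Cmp A f g = Idn A (Cod A f))"

lemma iso_simps:
  assumes "iso A f"
  shows "f \<in> Arr A" "cinv A f \<in> Arr A" "Dom A (cinv A f) = Cod A f" "Cod A (cinv A f) = Dom A f"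
    "Cmp A (cinv A f) f = Idn A (Dom A f)" "Cmp A f (cinv A f) = Idn A (Cod A f)"
proof -
  show "f \<in> Arr A" using assms by (simp add: iso_def)
  have "\<exists>g. g \<in> Arr A \<and> Dom A g = Cod A f \<and> Cod A g = Dom A f \<and>
     Cmp A g f = Idn A (Dom A f) \<and> Cmp A f g = Idn A (Cod A f)"
    using assms by (auto simp: iso_def)
  from someI_ex[OF this, folded cinv_def]
  show "cinv A f \<in> Arr A" "Dom A (cinv A f) = Cod A f" "Cod A (cinv A f) = Dom A f"
    "Cmp A (cinv A f) f = Idn A (Dom A f)" "Cmp A f (cinv A f) = Idn A (Cod A f)"
    by auto
qed

lemma iso_cancel:
  assumes "category A" and "iso A f"
  shows "\<And>g. g \<in> Arr A \<Longrightarrow> Cod A g = Dom A f \<Longrightarrow> Cmp A (cinv A f) (Cmp A f g) = g"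
    "\<And>g. g \<in> Arr A \<Longrightarrow> Cod A g = Cod A f \<Longrightarrow> Cmp A f (Cmp A (cinv A f) g) = g"
proof -
  note i = iso_simps[OF assms(2)]
  note c = category_simps[OF assms(1)]
  show "Cmp A (cinv A f) (Cmp A f g) = g" if g: "g \<in> Arr A" "Cod A g = Dom A f" for g
    using c(11)[OF g(1) i(1) i(2) g(2) i(3)[symmetric]] c(10)[OF g(1) g(2)[symmetric]]
    by (simp only: i)
  show "Cmp A f (Cmp A (cinv A f) g) = g" if g: "g \<in> Arr A" "Cod A g = Cod A f" for g
    using c(11)[OF g(1) i(2) i(1)] c(10)[OF g(1) g(2)[symmetric]] g(2)
    by (simp only: i)
qed

lemma isoI:
  assumes "f \<in> Arr A" "g \<in> Arr A" "Dom A g = Cod A f" "Cod A g = Dom A f"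
    "Cmp A g f = Idn A (Dom A f)" "Cmp A f g = Idn A (Cod A f)"
  shows "iso A f"
  using assms by (auto simp: iso_def)

lemma cinv_unique:
  assumes "category A" and "f \<in> Arr A" "g \<in> Arr A" "Dom A g = Cod A f" "Cod A g = Dom A f"
    "Cmp A g f = Idn A (Dom A f)" "Cmp A f g = Idn A (Cod A f)"
  shows "cinv A f = g"
proof -
  have i: "iso A f" by (rule isoI) (fact assms)+
  have "Cmp A (cinv A f) (Cmp A f g) = g"
    by (rule iso_cancel(1)[OF assms(1) i assms(3,5)])
  moreover have "Cmp A (cinv A f) (Idn A (Cod A f)) = cinv A f"
    by (simp add: category_simps(9)[OF assms(1)] iso_simps[OF i])
  ultimately show ?thesis using assms(7) by simp
qed

lemma iso_cinv: "iso A f \<Longrightarrow> iso A (cinv A f)"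
  by (rule isoI[of _ _ f]) (simp_all add: iso_simps)

lemma iso_Idn: "category A \<Longrightarrow> a \<in> Obj A \<Longrightarrow> iso A (Idn A a)"
  by (rule isoI[of _ _ "Idn A a"]) (simp_all add: category_simps)

lemma cinv_Idn: "category A \<Longrightarrow> a \<in> Obj A \<Longrightarrow> cinv A (Idn A a) = Idn A a"
  by (rule cinv_unique) (simp_all add: category_simps)

lemma iso_Cmp:
  assumes A: "category A" and f: "iso A f" and g: "iso A g" and "Cod A f = Dom A g"
  shows "iso A (Cmp A g f)"
proof (rule isoI[of _ _ "Cmp A (cinv A f) (cinv A g)"])
qed (use assms(4) in \<open>simp_all add: category_simps[OF A] iso_simps[OF f] iso_simps[OF g]
      iso_cancel[OF A f] iso_cancel[OF A g]\<close>)

lemma functor_simps: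
  assumes "is_functor F A B"
  shows "FDom F = A" "FCod F = B"
    "\<And>a. a \<in> Obj A \<Longrightarrow> FObj F a \<in> Obj B" "\<And>f. f \<in> Arr A \<Longrightarrow> FArr F f \<in> Arr B"
    "\<And>f. f \<in> Arr A \<Longrightarrow> Dom B (FArr F f) = FObj F (Dom A f)"
    "\<And>f. f \<in> Arr A \<Longrightarrow> Cod B (FArr F f) = FObj F (Cod A f)"
    "\<And>a. a \<in> Obj A \<Longrightarrow> FArr F (Idn A a) = Idn B (FObj F a)"
    "\<And>f g. f \<in> Arr A \<Longrightarrow> g \<in> Arr A \<Longrightarrow> Cod A f = Dom A g \<Longrightarrow>
      FArr F (Cmp A g f) = Cmp B (FArr F g) (FArr F f)"
  using assms by (auto simp: is_functor_def)

lemma functor_cats: "is_functor F A B \<Longrightarrow> category A" "is_functor F A B \<Longrightarrow> category B"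
  by (simp_all add: is_functor_def)

lemma functor_iso:
  assumes F: "is_functor F A B" and f: "iso A f"
  shows "iso B (FArr F f)" "cinv B (FArr F f) = FArr F (cinv A f)"
proof -
  note s = functor_simps[OF F] iso_simps[OF f] category_simps[OF functor_cats(1)[OF F]]
    category_simps[OF functor_cats(2)[OF F]]
  have c: "Cmp B (FArr F (cinv A f)) (FArr F f) = Idn B (FObj F (Dom A f))"
    "Cmp B (FArr F f) (FArr F (cinv A f)) = Idn B (FObj F (Cod A f))"
    using functor_simps(8)[OF F, of f "cinv A f"] functor_simps(8)[OF F, of "cinv A f" f]
    by (simp_all add: functor_simps(7)[OF F] iso_simps[OF f] category_simps[OF functor_cats(1)[OF F]])
  show "iso B (FArr F f)"
    by (rule isoI[of _ _ "FArr F (cinv A f)"]) (simp_all add: s c)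
  show "cinv B (FArr F f) = FArr F (cinv A f)"
    by (rule cinv_unique[OF functor_cats(2)[OF F]]) (simp_all add: s c)
qed

text \<open>Objects need no separate check, because a functor's value on an object can be read off
  from its value on the identity there.\<close>

lemma functor_eqI:
  assumes F: "is_functor F A B" and G: "is_functor G A B"
    and eq: "\<And>f. f \<in> Arr A \<Longrightarrow> FArr F f = FArr G f"
  shows "F = G"
proof -
  note s = functor_simps[OF F] functor_simps[OF G] category_simps[OF functor_cats(1)[OF F]]
    category_simps[OF functor_cats(2)[OF F]]
  have ob: "FObj F a = FObj G a" if a: "a \<in> Obj A" for a
  proof -
    have "Dom B (FArr F (Idn A a)) = Dom B (FArr G (Idn A a))" using eq a by (simp add: s)
    then show ?thesis using a functor_simps(3)[OF F a] functor_simps(3)[OF G a]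
      category_simps(4)[OF functor_cats(2)[OF F]] by (simp add: s)
  qed
  have e: "FObj F \<in> extensional (Obj A)" "FObj G \<in> extensional (Obj A)"
    "FArr F \<in> extensional (Arr A)" "FArr G \<in> extensional (Arr A)"
    using F G by (auto simp: is_functor_def PiE_def)
  show ?thesis
    using extensionalityI[OF e(1,2)] extensionalityI[OF e(3,4)] ob eq
    by (intro func.equality) (auto simp: s)
qed

lemma comp_simps:
  "FDom (G \<circ>\<^sub>F F) = FDom F" "FCod (G \<circ>\<^sub>F F) = FCod G"
  "a \<in> Obj (FDom F) \<Longrightarrow> FObj (G \<circ>\<^sub>F F) a = FObj G (FObj F a)"
  "f \<in> Arr (FDom F) \<Longrightarrow> FArr (G \<circ>\<^sub>F F) f = FArr G (FArr F f)"
  by (simp_all add: comp_functor_def)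

lemma is_functor_comp:
  assumes F: "is_functor F A B" and G: "is_functor G B C"
  shows "is_functor (G \<circ>\<^sub>F F) A C"
  using functor_cats(1)[OF F] functor_cats(2)[OF G]
  unfolding is_functor_def[of "G \<circ>\<^sub>F F"]
  by (auto simp: comp_functor_def functor_simps[OF F] functor_simps[OF G]
      category_simps[OF functor_cats(1)[OF F]])

lemma is_functor_id: "category A \<Longrightarrow> is_functor (id_functor A) A A"
  by (auto simp: is_functor_def id_functor_def category_simps)

lemma id_simps:
  "a \<in> Obj A \<Longrightarrow> FObj (id_functor A) a = a" "f \<in> Arr A \<Longrightarrow> FArr (id_functor A) f = f"
  "FDom (id_functor A) = A" "FCod (id_functor A) = A"
  by (simp_all add: id_functor_def)

lemma comp_id:
  assumes F: "is_functor F A B"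
  shows "F \<circ>\<^sub>F id_functor A = F" "id_functor B \<circ>\<^sub>F F = F"
  using functor_cats[OF F]
  by (auto intro!: functor_eqI[OF is_functor_comp F] intro: F is_functor_id
      simp: comp_simps id_simps functor_simps[OF F])

lemma comp_assoc:
  assumes F: "is_functor F A B" and G: "is_functor G B C" and H: "is_functor H C D"
  shows "H \<circ>\<^sub>F (G \<circ>\<^sub>F F) = (H \<circ>\<^sub>F G) \<circ>\<^sub>F F"
  by (rule functor_eqI[of _ A D])
    (auto intro!: is_functor_comp F G H simp: comp_simps functor_simps[OF F] functor_simps[OF G]
      intro: is_functor_comp[OF F G] is_functor_comp[OF G H])

lemma comp_eqD:
  assumes "G \<circ>\<^sub>F F = G' \<circ>\<^sub>F F'" and "FDom F = A" "FDom F' = A"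
  shows "\<And>a. a \<in> Obj A \<Longrightarrow> FObj G (FObj F a) = FObj G' (FObj F' a)"
    "\<And>f. f \<in> Arr A \<Longrightarrow> FArr G (FArr F f) = FArr G' (FArr F' f)"
  using assms comp_simps(3)[of _ F G] comp_simps(3)[of _ F' G'] comp_simps(4)[of _ F G]
    comp_simps(4)[of _ F' G'] by auto

section \<open>Conjugating a functor by isomorphisms\<close>

text \<open>For \<open>t a\<close> an isomorphism out of \<open>F a\<close>, this is the only functor for which \<open>t\<close> is a natural
  isomorphism out of \<open>F\<close>. No naturality is asked of \<open>t\<close>, so \<open>t\<close> can be chosen object by object.\<close>

definition twist :: "('o, 'm, 'p, 'n) func \<Rightarrow> ('o \<Rightarrow> 'n) \<Rightarrow> ('o, 'm, 'p, 'n) func" where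
  "twist F t = \<lparr>FDom = FDom F, FCod = FCod F,
     FObj = (\<lambda>a\<in>Obj (FDom F). Cod (FCod F) (t a)),
     FArr = (\<lambda>f\<in>Arr (FDom F). Cmp (FCod F) (t (Cod (FDom F) f))
       (Cmp (FCod F) (FArr F f) (cinv (FCod F) (t (Dom (FDom F) f)))))\<rparr>"

lemma twist_simps:
  assumes "is_functor F A B"
  shows "FDom (twist F t) = A" "FCod (twist F t) = B"
    "\<And>a. a \<in> Obj A \<Longrightarrow> FObj (twist F t) a = Cod B (t a)"
    "\<And>f. f \<in> Arr A \<Longrightarrow> FArr (twist F t) f =
      Cmp B (t (Cod A f)) (Cmp B (FArr F f) (cinv B (t (Dom A f))))"
  by (simp_all add: twist_def functor_simps[OF assms])

lemma is_functor_twist: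
  assumes F: "is_functor F A B"
    and t: "\<And>a. a \<in> Obj A \<Longrightarrow> iso B (t a)" "\<And>a. a \<in> Obj A \<Longrightarrow> Dom B (t a) = FObj F a"
  shows "is_functor (twist F t) A B"
proof -
  have A: "category A" and B: "category B" using functor_cats[OF F] by auto
  note s = functor_simps[OF F] category_simps[OF A] category_simps[OF B] t(2)
    iso_simps[OF t(1)] iso_cancel[OF B t(1)]
  show ?thesis using A B
    by (auto simp: is_functor_def twist_def s)
qed

text \<open>Naturality of \<open>t\<close> determines \<open>G\<close> on arrows, since the components can be cancelled.\<close>

lemma twist_eqI:
  assumes F: "is_functor F A B" and G: "is_functor G A B"
    and t: "\<And>a. a \<in> Obj A \<Longrightarrow> iso B (t a)" "\<And>a. a \<in> Obj A \<Longrightarrow> Dom B (t a) = FObj F a"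
    "\<And>a. a \<in> Obj A \<Longrightarrow> Cod B (t a) = FObj G a"
    and nat: "\<And>f. f \<in> Arr A \<Longrightarrow>
      Cmp B (t (Cod A f)) (FArr F f) = Cmp B (FArr G f) (t (Dom A f))"
  shows "twist F t = G"
proof (rule functor_eqI[OF is_functor_twist[OF F t(1,2)] G])
  have A: "category A" and B: "category B" using functor_cats[OF F] by auto
  note s = functor_simps[OF F] functor_simps[OF G] category_simps[OF A] category_simps[OF B] t(2,3)
    iso_simps[OF t(1)]
  fix f assume f: "f \<in> Arr A"
  have "FArr (twist F t) f = Cmp B (Cmp B (t (Cod A f)) (FArr F f)) (cinv B (t (Dom A f)))"
    using f by (simp add: twist_simps[OF F] s)
  also have "\<dots> = FArr G f" using f by (simp only: nat) (simp add: s)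
  finally show "FArr (twist F t) f = FArr G f" .
qed

lemma comp_twist:
  assumes F: "is_functor F A B" and G: "is_functor G B C"
    and t: "\<And>a. a \<in> Obj A \<Longrightarrow> iso B (t a)" "\<And>a. a \<in> Obj A \<Longrightarrow> Dom B (t a) = FObj F a"
  shows "G \<circ>\<^sub>F twist F t = twist (G \<circ>\<^sub>F F) (\<lambda>a. FArr G (t a))"
proof -
  have A: "category A" and B: "category B" using functor_cats[OF F] by auto
  note s = functor_simps[OF F] functor_simps[OF G] category_simps[OF A] category_simps[OF B] t(2)
    iso_simps[OF t(1)]
  show ?thesis
    by (rule functor_eqI[OF is_functor_comp[OF is_functor_twist[OF F t] G]
          is_functor_twist[OF is_functor_comp[OF F G]]])
      (auto simp: comp_simps s twist_simps[OF F] twist_simps[OF is_functor_comp[OF F G]]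
        functor_iso[OF G] t)
qed

section \<open>Fully faithful functors\<close>

definition fully_faithful ::
    "('o, 'm, 'p, 'n) func \<Rightarrow> ('o, 'm) cat \<Rightarrow> ('p, 'n) cat \<Rightarrow> bool" where
  "fully_faithful F A B \<longleftrightarrow> is_functor F A B \<and>
     (\<forall>a\<in>Obj A. \<forall>b\<in>Obj A. \<forall>g\<in>Arr B. Dom B g = FObj F a \<longrightarrow> Cod B g = FObj F b \<longrightarrow>
        (\<exists>f\<in>Arr A. Dom A f = a \<and> Cod A f = b \<and> FArr F f = g)) \<and>
     (\<forall>f\<in>Arr A. \<forall>g\<in>Arr A. Dom A f = Dom A g \<longrightarrow> Cod A f = Cod A g \<longrightarrow>
        FArr F f = FArr F g \<longrightarrow> f = g)"

definition essentially_surjective ::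
    "('o, 'm, 'p, 'n) func \<Rightarrow> ('o, 'm) cat \<Rightarrow> ('p, 'n) cat \<Rightarrow> bool" where
  "essentially_surjective F A B \<longleftrightarrow>
     (\<forall>b\<in>Obj B. \<exists>a\<in>Obj A. \<exists>f. iso B f \<and> Dom B f = FObj F a \<and> Cod B f = b)"

lemma ff_functor: "fully_faithful F A B \<Longrightarrow> is_functor F A B"
  by (simp add: fully_faithful_def)

lemma ff_full:
  assumes "fully_faithful F A B" "a \<in> Obj A" "b \<in> Obj A" "g \<in> Arr B"
    "Dom B g = FObj F a" "Cod B g = FObj F b"
  obtains f where "f \<in> Arr A" "Dom A f = a" "Cod A f = b" "FArr F f = g"
  using assms unfolding fully_faithful_def by blast

lemma ff_faithful:
  assumes "fully_faithful F A B" "f \<in> Arr A" "g \<in> Arr A"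
    "Dom A f = Dom A g" "Cod A f = Cod A g" "FArr F f = FArr F g"
  shows "f = g"
  using assms by (auto simp: fully_faithful_def)

text \<open>Fully faithful functors reflect isomorphisms: the inverse lifts too, and faithfulness turns the
  lifts into mutually inverse arrows.\<close>

lemma ff_full_iso:
  assumes F: "fully_faithful F A B" and ab: "a \<in> Obj A" "b \<in> Obj A" and g: "iso B g"
    and dc: "Dom B g = FObj F a" "Cod B g = FObj F b"
  obtains f where "iso A f" "Dom A f = a" "Cod A f = b" "FArr F f = g"
proof -
  note F' = ff_functor[OF F]
  have A: "category A" using functor_cats[OF F'] by auto
  note s = functor_simps[OF F'] category_simps[OF A] iso_simps[OF g]
  obtain f where f: "f \<in> Arr A" "Dom A f = a" "Cod A f = b" "FArr F f = g"
    using ff_full[OF F ab _ dc] g by (auto simp: s)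
  obtain h where h: "h \<in> Arr A" "Dom A h = b" "Cod A h = a" "FArr F h = cinv B g"
    using ff_full[OF F ab(2,1), of "cinv B g"] dc by (auto simp: s)
  have "Cmp A h f = Idn A a" "Cmp A f h = Idn A b"
    by (rule ff_faithful[OF F]; simp add: s f h ab dc)+
  then have "iso A f" using f h by (intro isoI[of _ _ h]) auto
  with f that show ?thesis by blast
qed

text \<open>The arrow part of the lift is forced, and functoriality follows from faithfulness.\<close>

lemma ff_lift:
  assumes F: "fully_faithful F A B" and G: "is_functor G C B"
    and ob: "\<And>c. c \<in> Obj C \<Longrightarrow> ob c \<in> Obj A" "\<And>c. c \<in> Obj C \<Longrightarrow> FObj F (ob c) = FObj G c"
  obtains L where "is_functor L C A" "\<And>c. c \<in> Obj C \<Longrightarrow> FObj L c = ob c" "F \<circ>\<^sub>F L = G"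
proof -
  note F' = ff_functor[OF F]
  have A: "category A" and C: "category C" using functor_cats[OF F'] functor_cats[OF G] by auto
  note s = functor_simps[OF F'] functor_simps[OF G] category_simps[OF A] category_simps[OF C] ob
  have "\<forall>f\<in>Arr C. \<exists>u. u \<in> Arr A \<and> Dom A u = ob (Dom C f) \<and> Cod A u = ob (Cod C f) \<and>
      FArr F u = FArr G f"
  proof
    fix f assume f: "f \<in> Arr C"
    show "\<exists>u. u \<in> Arr A \<and> Dom A u = ob (Dom C f) \<and> Cod A u = ob (Cod C f) \<and> FArr F u = FArr G f"
      using ff_full[OF F, of "ob (Dom C f)" "ob (Cod C f)" "FArr G f"] f
      by (metis s(3-6,9-14,19,20,30,31) ob category_simps(1,2)[OF C])
  qed
  then obtain l where l: "\<And>f. f \<in> Arr C \<Longrightarrow> l f \<in> Arr A"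
    "\<And>f. f \<in> Arr C \<Longrightarrow> Dom A (l f) = ob (Dom C f)" "\<And>f. f \<in> Arr C \<Longrightarrow> Cod A (l f) = ob (Cod C f)"
    "\<And>f. f \<in> Arr C \<Longrightarrow> FArr F (l f) = FArr G f"
    by metis
  define L where "L = \<lparr>FDom = C, FCod = A, FObj = restrict ob (Obj C), FArr = restrict l (Arr C)\<rparr>"
  have "l (Idn C c) = Idn A (ob c)" if "c \<in> Obj C" for c
    by (rule ff_faithful[OF F]) (simp_all add: s l that)
  moreover have "l (Cmp C g f) = Cmp A (l g) (l f)"
    if "f \<in> Arr C" "g \<in> Arr C" "Cod C f = Dom C g" for f g
    by (rule ff_faithful[OF F]) (simp_all add: s l that)
  ultimately have L: "is_functor L C A"
    using A C by (auto simp: is_functor_def L_def s l)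
  show ?thesis
  proof (rule that[OF L])
    show "F \<circ>\<^sub>F L = G"
      by (rule functor_eqI[OF is_functor_comp[OF L F'] G]) (simp add: L_def comp_simps l)
  qed (simp add: L_def)
qed

section \<open>Equivalences\<close>

lemma nat_iso_id_iff:
  assumes "is_functor E A A"
  shows "nat_iso E (id_functor A) s \<longleftrightarrow>
    (\<forall>a\<in>Obj A. iso A (s a) \<and> Dom A (s a) = FObj E a \<and> Cod A (s a) = a) \<and>
    (\<forall>f\<in>Arr A. Cmp A (s (Cod A f)) (FArr E f) = Cmp A f (s (Dom A f)))"
  by (auto simp: nat_iso_def functor_simps[OF assms] id_simps)

lemma nat_iso_id_conj:
  assumes E: "is_functor E A A" and s: "nat_iso E (id_functor A) s" and f: "f \<in> Arr A"
  shows "Cmp A (s (Cod A f)) (Cmp A (FArr E f) (cinv A (s (Dom A f)))) = f"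
proof -
  note n = s[unfolded nat_iso_id_iff[OF E]]
  have "twist E s = id_functor A"
    using n functor_cats[OF E]
    by (intro twist_eqI[OF E is_functor_id]) (auto simp: id_simps)
  then have "FArr (twist E s) f = f" using f by (simp add: id_simps)
  then show ?thesis using f by (simp add: twist_simps[OF E])
qed

text \<open>By naturality \<open>f\<close> can be recovered from \<open>G (F f)\<close>.\<close>

lemma nat_iso_id_faithful:
  assumes F: "is_functor F A B" and G: "is_functor G B A"
    and s: "nat_iso (G \<circ>\<^sub>F F) (id_functor A) s"
    and fg: "f \<in> Arr A" "g \<in> Arr A" "Dom A f = Dom A g" "Cod A f = Cod A g"
      "FArr F f = FArr F g"
  shows "f = g"
  using nat_iso_id_conj[OF is_functor_comp[OF F G] s fg(1)]
    nat_iso_id_conj[OF is_functor_comp[OF F G] s fg(2)] fg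
  by (simp add: comp_simps functor_simps[OF F])

lemma equivalence_imp_ff_es:
  assumes F: "is_functor F A B" and "equivalence F"
  shows "fully_faithful F A B" "essentially_surjective F A B"
proof -
  obtain G s t where G: "is_functor G B A"
    and s: "nat_iso (G \<circ>\<^sub>F F) (id_functor A) s" and t: "nat_iso (F \<circ>\<^sub>F G) (id_functor B) t"
    using assms(2) by (auto simp: equivalence_def functor_simps[OF F])
  note GF = is_functor_comp[OF F G]
  note FG = is_functor_comp[OF G F]
  have A: "category A" and B: "category B" using functor_cats[OF F] by auto
  have si: "iso A (s a)" "Dom A (s a) = FObj G (FObj F a)" "Cod A (s a) = a" if "a \<in> Obj A" for a
    using s[unfolded nat_iso_id_iff[OF GF]] that by (auto simp: comp_simps functor_simps[OF F])
  note s1 = functor_simps[OF F] functor_simps[OF G] category_simps[OF A] category_simps[OF B]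
    si iso_simps[OF si(1)] iso_cancel[OF A si(1)] comp_simps
  have "\<exists>f\<in>Arr A. Dom A f = a \<and> Cod A f = b \<and> FArr F f = g"
    if ab: "a \<in> Obj A" "b \<in> Obj A" and g: "g \<in> Arr B" "Dom B g = FObj F a" "Cod B g = FObj F b"
    for a b g
  proof -
    let ?f = "Cmp A (s b) (Cmp A (FArr G g) (cinv A (s a)))"
    have f: "?f \<in> Arr A" "Dom A ?f = a" "Cod A ?f = b" using ab g by (simp_all add: s1)
    \<comment> \<open>Conjugating \<open>G (F f)\<close> and conjugating \<open>G g\<close> both give \<open>f\<close>, and \<open>G\<close> is faithful.\<close>
    have r: "Cmp A (cinv A (s b)) (Cmp A (Cmp A (s b) (Cmp A h (cinv A (s a)))) (s a)) = h"
      if "h \<in> Arr A" "Dom A h = FObj G (FObj F a)" "Cod A h = FObj G (FObj F b)" for h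
      using that ab by (simp add: s1)
    have "Cmp A (s b) (Cmp A (FArr G (FArr F ?f)) (cinv A (s a))) = ?f"
      using nat_iso_id_conj[OF GF s f(1)] f by (simp add: comp_simps functor_simps[OF F])
    then have "FArr G (FArr F ?f) = FArr G g"
      using r[of "FArr G (FArr F ?f)"] r[of "FArr G g"] f g
      by (simp add: functor_simps[OF F] functor_simps[OF G])
    then have "FArr F ?f = g"
      using f g by (intro nat_iso_id_faithful[OF G F t]) (simp_all add: functor_simps[OF F])
    then show ?thesis using f by blast
  qed
  then show "fully_faithful F A B"
    using F nat_iso_id_faithful[OF F G s] unfolding fully_faithful_def by blast
  show "essentially_surjective F A B"
    unfolding essentially_surjective_def
  proof
    fix b assume "b \<in> Obj B"
    then have "FObj G b \<in> Obj A" "iso B (t b) \<and> Dom B (t b) = FObj F (FObj G b) \<and> Cod B (t b) = b"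
      using t[unfolded nat_iso_id_iff[OF FG]] by (auto simp: comp_simps functor_simps[OF G])
    then show "\<exists>a\<in>Obj A. \<exists>f. iso B f \<and> Dom B f = FObj F a \<and> Cod B f = b" by blast
  qed
qed

text \<open>The quasi-inverse is the identity of the target, conjugated into the image and then lifted
  through the functor.\<close>

lemma ff_es_imp_equivalence:
  assumes F: "fully_faithful F A B" and es: "essentially_surjective F A B"
  shows "equivalence F"
proof -
  note F' = ff_functor[OF F]
  have A: "category A" and B: "category B" using functor_cats[OF F'] by auto
  obtain ob t where ob: "\<And>b. b \<in> Obj B \<Longrightarrow> ob b \<in> Obj A"
    and t: "\<And>b. b \<in> Obj B \<Longrightarrow> iso B (t b)" "\<And>b. b \<in> Obj B \<Longrightarrow> Dom B (t b) = FObj F (ob b)"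
      "\<And>b. b \<in> Obj B \<Longrightarrow> Cod B (t b) = b"
    using es unfolding essentially_surjective_def by metis
  note I = is_functor_id[OF B]
  let ?M = "twist (id_functor B) (\<lambda>b. cinv B (t b))"
  have M: "is_functor ?M B B"
    by (rule is_functor_twist[OF I]) (simp_all add: iso_cinv iso_simps t id_simps)
  obtain G where G: "is_functor G B A" and Gob: "\<And>b. b \<in> Obj B \<Longrightarrow> FObj G b = ob b"
    and FG: "F \<circ>\<^sub>F G = ?M"
    by (rule ff_lift[OF F M ob]) (auto simp: twist_simps[OF I] iso_simps t)
  have cc: "cinv B (cinv B (t b)) = t b" if "b \<in> Obj B" for b
    by (rule cinv_unique[OF B]) (simp_all add: iso_simps t that)
  note s1 = functor_simps[OF F'] functor_simps[OF G] category_simps[OF A] category_simps[OF B]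
    t(2,3) iso_simps[OF t(1)] iso_cancel[OF B t(1)] comp_simps ob Gob cc
  have nt: "nat_iso (F \<circ>\<^sub>F G) (id_functor B) t"
    unfolding FG nat_iso_id_iff[OF M]
    by (auto simp: twist_simps[OF I] id_simps s1 t(1))
  have FGf: "Cmp B (t (Cod B f)) (FArr F (FArr G f)) = Cmp B f (t (Dom B f))"
    if "f \<in> Arr B" for f
    using nt[unfolded nat_iso_id_iff[OF is_functor_comp[OF G F']]] that by (simp add: s1)
  have "\<exists>s. iso A s \<and> Dom A s = ob (FObj F a) \<and> Cod A s = a \<and> FArr F s = t (FObj F a)"
    if a: "a \<in> Obj A" for a
    by (rule ff_full_iso[OF F, of "ob (FObj F a)" a "t (FObj F a)"]) (auto simp: s1 t(1) a)
  then obtain s where s: "\<And>a. a \<in> Obj A \<Longrightarrow> iso A (s a)"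
    "\<And>a. a \<in> Obj A \<Longrightarrow> Dom A (s a) = ob (FObj F a)" "\<And>a. a \<in> Obj A \<Longrightarrow> Cod A (s a) = a"
    "\<And>a. a \<in> Obj A \<Longrightarrow> FArr F (s a) = t (FObj F a)" by metis
  note s2 = s1 s iso_simps[OF s(1)]
  have "Cmp A (s (Cod A f)) (FArr G (FArr F f)) = Cmp A f (s (Dom A f))" if f: "f \<in> Arr A" for f
    by (rule ff_faithful[OF F]) (use FGf[of "FArr F f"] f in \<open>simp_all add: s2\<close>)
  then have ns: "nat_iso (G \<circ>\<^sub>F F) (id_functor A) s"
    unfolding nat_iso_id_iff[OF is_functor_comp[OF F' G]] by (simp add: s2)
  show ?thesis
    unfolding equivalence_def using F' G ns nt by (auto simp: functor_simps[OF F'])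
qed

lemma equivalence_iff:
  assumes "is_functor F A B"
  shows "equivalence F \<longleftrightarrow> fully_faithful F A B \<and> essentially_surjective F A B"
  using equivalence_imp_ff_es[OF assms] ff_es_imp_equivalence by blast

lemma ff_comp:
  assumes F: "fully_faithful F A B" and G: "fully_faithful G B C"
  shows "fully_faithful (G \<circ>\<^sub>F F) A C"
proof -
  note F' = ff_functor[OF F] and G' = ff_functor[OF G]
  note s = functor_simps[OF F'] functor_simps[OF G'] comp_simps
  have "\<exists>f\<in>Arr A. Dom A f = a \<and> Cod A f = b \<and> FArr (G \<circ>\<^sub>F F) f = g"
    if ab: "a \<in> Obj A" "b \<in> Obj A" and g: "g \<in> Arr C" "Dom C g = FObj (G \<circ>\<^sub>F F) a"
      "Cod C g = FObj (G \<circ>\<^sub>F F) b" for a b g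
  proof -
    obtain h where h: "h \<in> Arr B" "Dom B h = FObj F a" "Cod B h = FObj F b" "FArr G h = g"
      by (rule ff_full[OF G, of "FObj F a" "FObj F b" g]) (use ab g in \<open>auto simp: s\<close>)
    obtain f where "f \<in> Arr A" "Dom A f = a" "Cod A f = b" "FArr F f = h"
      by (rule ff_full[OF F ab h(1-3)])
    with h show ?thesis by (auto simp: s)
  qed
  moreover have "f = g" if "f \<in> Arr A" "g \<in> Arr A" "Dom A f = Dom A g" "Cod A f = Cod A g"
    "FArr (G \<circ>\<^sub>F F) f = FArr (G \<circ>\<^sub>F F) g" for f g
    by (rule ff_faithful[OF F that(1-4)], rule ff_faithful[OF G]) (use that in \<open>auto simp: s\<close>)
  ultimately show ?thesis
    using is_functor_comp[OF F' G'] unfolding fully_faithful_def by blast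
qed

lemma ff_cancel_left:
  assumes F: "is_functor F A B" and G: "fully_faithful G B C"
    and GF: "fully_faithful (G \<circ>\<^sub>F F) A C"
  shows "fully_faithful F A B"
proof -
  note G' = ff_functor[OF G]
  note s = functor_simps[OF F] functor_simps[OF G'] comp_simps
  have "\<exists>f\<in>Arr A. Dom A f = a \<and> Cod A f = b \<and> FArr F f = g"
    if ab: "a \<in> Obj A" "b \<in> Obj A" and g: "g \<in> Arr B" "Dom B g = FObj F a"
      "Cod B g = FObj F b" for a b g
  proof -
    obtain f where f: "f \<in> Arr A" "Dom A f = a" "Cod A f = b" "FArr (G \<circ>\<^sub>F F) f = FArr G g"
      by (rule ff_full[OF GF ab, of "FArr G g"]) (use ab g in \<open>auto simp: s\<close>)
    have "FArr F f = g"
      by (rule ff_faithful[OF G]) (use f g in \<open>auto simp: s\<close>)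
    with f show ?thesis by blast
  qed
  moreover have "f = g" if "f \<in> Arr A" "g \<in> Arr A" "Dom A f = Dom A g" "Cod A f = Cod A g"
    "FArr F f = FArr F g" for f g
    by (rule ff_faithful[OF GF that(1-4)]) (use that in \<open>auto simp: s\<close>)
  ultimately show ?thesis
    using F unfolding fully_faithful_def by blast
qed

lemma es_comp:
  assumes F: "is_functor F A B" and G: "is_functor G B C"
    and eF: "essentially_surjective F A B" and eG: "essentially_surjective G B C"
  shows "essentially_surjective (G \<circ>\<^sub>F F) A C"
  unfolding essentially_surjective_def
proof
  note C = functor_cats(2)[OF G]
  fix c assume "c \<in> Obj C"
  then obtain b g where b: "b \<in> Obj B" and g: "iso C g" "Dom C g = FObj G b" "Cod C g = c"
    using eG by (auto simp: essentially_surjective_def)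
  obtain a f where a: "a \<in> Obj A" and f: "iso B f" "Dom B f = FObj F a" "Cod B f = b"
    using eF b by (auto simp: essentially_surjective_def)
  note s = functor_simps[OF F] functor_simps[OF G] comp_simps category_simps[OF C]
    iso_simps[OF f(1)] iso_simps[OF g(1)]
  have "iso C (Cmp C g (FArr G f))"
    by (rule iso_Cmp[OF C functor_iso(1)[OF G f(1)] g(1)]) (simp add: s f g)
  moreover have "Dom C (Cmp C g (FArr G f)) = FObj (G \<circ>\<^sub>F F) a" "Cod C (Cmp C g (FArr G f)) = c"
    using a by (simp_all add: s f(2,3) g(2,3))
  ultimately show "\<exists>a\<in>Obj A. \<exists>f. iso C f \<and> Dom C f = FObj (G \<circ>\<^sub>F F) a \<and> Cod C f = c"
    using a by blast
qed

lemma es_cancel_right: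
  assumes F: "is_functor F A B" and es: "essentially_surjective (G \<circ>\<^sub>F F) A C"
  shows "essentially_surjective G B C"
  using es functor_simps[OF F] unfolding essentially_surjective_def
  by (metis comp_simps(3))

lemma es_cancel_left:
  assumes F: "is_functor F A B" and G: "fully_faithful G B C"
    and es: "essentially_surjective (G \<circ>\<^sub>F F) A C"
  shows "essentially_surjective F A B"
  unfolding essentially_surjective_def
proof
  note G' = ff_functor[OF G]
  note s = functor_simps[OF F] functor_simps[OF G'] comp_simps
  fix b assume b: "b \<in> Obj B"
  then obtain a g where a: "a \<in> Obj A" and g: "iso C g" "Dom C g = FObj G (FObj F a)"
    "Cod C g = FObj G b"
    using es[unfolded essentially_surjective_def, rule_format, of "FObj G b"] by (auto simp: s)
  show "\<exists>a\<in>Obj A. \<exists>f. iso B f \<and> Dom B f = FObj F a \<and> Cod B f = b"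
    by (rule ff_full_iso[OF G _ b g]) (use a in \<open>auto simp: s\<close>)
qed

text \<open>Every arrow of the middle category is conjugate to one in the image of \<open>F\<close>, where \<open>G\<close> is
  controlled by the composite.\<close>

lemma ff_cancel_right:
  assumes F: "fully_faithful F A B" and es: "essentially_surjective F A B"
    and G: "is_functor G B C" and GF: "fully_faithful (G \<circ>\<^sub>F F) A C"
  shows "fully_faithful G B C"
proof -
  note F' = ff_functor[OF F]
  have B: "category B" and C: "category C" using functor_cats[OF G] by auto
  obtain ob t where ob: "\<And>b. b \<in> Obj B \<Longrightarrow> ob b \<in> Obj A"
    and t: "\<And>b. b \<in> Obj B \<Longrightarrow> iso B (t b)" "\<And>b. b \<in> Obj B \<Longrightarrow> Dom B (t b) = FObj F (ob b)"
      "\<And>b. b \<in> Obj B \<Longrightarrow> Cod B (t b) = b"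
    using es unfolding essentially_surjective_def by metis
  have Gt: "iso C (FArr G (t b))" "cinv C (FArr G (t b)) = FArr G (cinv B (t b))"
    if "b \<in> Obj B" for b
    using functor_iso[OF G t(1)[OF that]] .
  note s = functor_simps[OF F'] functor_simps[OF G] category_simps[OF B] category_simps[OF C]
    t(2,3) iso_simps[OF t(1)] iso_cancel[OF B t(1)] comp_simps ob
  have "\<exists>f\<in>Arr B. Dom B f = a \<and> Cod B f = b \<and> FArr G f = g"
    if ab: "a \<in> Obj B" "b \<in> Obj B" and g: "g \<in> Arr C" "Dom C g = FObj G a"
      "Cod C g = FObj G b" for a b g
  proof -
    let ?g = "Cmp C (FArr G (cinv B (t b))) (Cmp C g (FArr G (t a)))"
    obtain f where f: "f \<in> Arr A" "Dom A f = ob a" "Cod A f = ob b" "FArr (G \<circ>\<^sub>F F) f = ?g"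
      by (rule ff_full[OF GF, of "ob a" "ob b" ?g]) (use ab g in \<open>auto simp: s\<close>)
    let ?f = "Cmp B (t b) (Cmp B (FArr F f) (cinv B (t a)))"
    have "FArr G (FArr F f) = ?g" using f by (simp add: s)
    then have "FArr G ?f = g" using f(1-3) ab g iso_cancel[OF C Gt(1)]
      iso_simps(5,6)[OF Gt(1)] by (simp add: s Gt(2))
    moreover have "?f \<in> Arr B" "Dom B ?f = a" "Cod B ?f = b" using f(1-3) ab by (simp_all add: s)
    ultimately show ?thesis by blast
  qed
  moreover have "f = g" if fg: "f \<in> Arr B" "g \<in> Arr B" "Dom B f = Dom B g" "Cod B f = Cod B g"
    "FArr G f = FArr G g" for f g
  proof -
    let ?c = "\<lambda>f. Cmp B (cinv B (t (Cod B g))) (Cmp B f (t (Dom B g)))"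
    obtain f' where f': "f' \<in> Arr A" "Dom A f' = ob (Dom B g)" "Cod A f' = ob (Cod B g)"
      "FArr F f' = ?c f"
      by (rule ff_full[OF F, of "ob (Dom B g)" "ob (Cod B g)" "?c f"]) (use fg in \<open>auto simp: s\<close>)
    obtain g' where g': "g' \<in> Arr A" "Dom A g' = ob (Dom B g)" "Cod A g' = ob (Cod B g)"
      "FArr F g' = ?c g"
      by (rule ff_full[OF F, of "ob (Dom B g)" "ob (Cod B g)" "?c g"]) (use fg in \<open>auto simp: s\<close>)
    have "f' = g'"
      by (rule ff_faithful[OF GF]) (use f' g' fg in \<open>auto simp: s\<close>)
    then have c: "?c f = ?c g" using f' g' by simp
    have r: "h = Cmp B (t (Cod B g)) (Cmp B (?c h) (cinv B (t (Dom B g))))"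
      if "h \<in> Arr B" "Dom B h = Dom B g" "Cod B h = Cod B g" for h
      using that fg by (simp add: s)
    show "f = g" using r[OF fg(1,3,4)] r[OF fg(2)] c by simp
  qed
  ultimately show ?thesis
    using G unfolding fully_faithful_def by blast
qed

lemma equivalence_comp:
  assumes F: "is_functor F A B" and G: "is_functor G B C"
  shows "equivalence F \<Longrightarrow> equivalence G \<Longrightarrow> equivalence (G \<circ>\<^sub>F F)"
    "equivalence F \<Longrightarrow> equivalence (G \<circ>\<^sub>F F) \<Longrightarrow> equivalence G"
    "equivalence G \<Longrightarrow> equivalence (G \<circ>\<^sub>F F) \<Longrightarrow> equivalence F"
  unfolding equivalence_iff[OF F] equivalence_iff[OF G] equivalence_iff[OF is_functor_comp[OF F G]]
  using ff_comp es_comp[OF F G] ff_cancel_left[OF F] ff_cancel_right[OF _ _ G]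
    es_cancel_left[OF F] es_cancel_right[OF F] by blast+

section \<open>Paths and iso-fibrations\<close>

lemma interval_simps:
  "Obj interval = UNIV" "Arr interval = UNIV" "Dom interval = fst" "Cod interval = snd"
  "Idn interval x = (x, x)" "Cmp interval g f = (fst f, snd g)"
  by (simp_all add: interval_def)

lemma category_interval: "category interval"
  using groupoid_interval by (simp add: groupoid_def)

lemma iso_interval: "iso interval f"
  using groupoid_interval by (cases f) (simp add: groupoid_def interval_simps)

lemma cinv_interval: "cinv interval (x, y) = (y, x)"
  by (rule cinv_unique[OF category_interval]) (auto simp: interval_def)

lemma category_one: "category one_cat"
  by (auto simp: category_def one_cat_def)

definition const_functor ::
    "('o, 'm) cat \<Rightarrow> ('p, 'n) cat \<Rightarrow> 'p \<Rightarrow> ('o, 'm, 'p, 'n) func" where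
  "const_functor C A a = \<lparr>FDom = C, FCod = A, FObj = (\<lambda>_\<in>Obj C. a), FArr = (\<lambda>_\<in>Arr C. Idn A a)\<rparr>"

lemma is_functor_const:
  "category C \<Longrightarrow> category A \<Longrightarrow> a \<in> Obj A \<Longrightarrow> is_functor (const_functor C A a) C A"
  by (auto simp: is_functor_def const_functor_def category_simps)

lemma const_simps:
  "a \<in> Obj C \<Longrightarrow> FObj (const_functor C A x) a = x"
  "f \<in> Arr C \<Longrightarrow> FArr (const_functor C A x) f = Idn A x"
  by (simp_all add: const_functor_def)

text \<open>The constant functor at the source of \<open>f\<close>, conjugated by \<open>f\<close> at the far end.\<close>

lemma path_exists:
  assumes A: "category A" and f: "iso A f"
  obtains H where "is_functor H interval A" "FArr H (False, True) = f"
proof -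
  have ob: "Dom A f \<in> Obj A" using A f by (simp add: category_simps iso_simps)
  note K = is_functor_const[OF category_interval A ob]
  let ?t = "\<lambda>x. if x then f else Idn A (Dom A f)"
  have "is_functor (twist (const_functor interval A (Dom A f)) ?t) interval A"
    by (rule is_functor_twist[OF K])
      (auto simp: f iso_Idn[OF A ob] const_simps interval_simps category_simps[OF A] ob)
  moreover have "FArr (twist (const_functor interval A (Dom A f)) ?t) (False, True) = f"
    by (simp add: twist_simps[OF K] interval_simps const_simps cinv_Idn[OF A ob]
        category_simps[OF A] iso_simps[OF f] ob)
  ultimately show ?thesis using that by blast
qed

lemma interval_functor_eqI:
  assumes H: "is_functor H interval A" and H': "is_functor H' interval A"
    and eq: "FArr H (False, True) = FArr H' (False, True)"
  shows "H = H'"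
proof (rule functor_eqI[OF H H'])
  fix p :: "bool \<times> bool"
  have ob: "FObj H x = FObj H' x" for x
    using functor_simps(5,6)[OF H, of "(False, True)"] functor_simps(5,6)[OF H', of "(False, True)"] eq
    by (cases x) (simp_all add: interval_simps)
  have "FArr H (x, x) = FArr H' (x, x)" for x
    using functor_simps(7)[OF H, of x] functor_simps(7)[OF H', of x] ob by (simp add: interval_simps)
  moreover have "FArr H (True, False) = FArr H' (True, False)"
    using functor_iso(2)[OF H iso_interval, of "(False, True)"]
      functor_iso(2)[OF H' iso_interval, of "(False, True)"] eq by (simp add: cinv_interval)
  ultimately show "FArr H p = FArr H' p" using eq by (cases p; cases "fst p"; cases "snd p") auto
qed

lemma is_functor_end0: "is_functor end0 one_cat interval"
  using category_one category_interval
  by (auto simp: is_functor_def end0_def one_cat_def interval_def)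

lemma one_simps: "Obj one_cat = UNIV" "Arr one_cat = UNIV" "Idn one_cat x = ()"
  by (simp_all add: one_cat_def)

lemma end0_simps: "FObj end0 x = False" "FArr end0 y = (False, False)"
  by (simp_all add: end0_def)

lemma one_functor_eqI:
  assumes F: "is_functor F one_cat A" and G: "is_functor G one_cat A" and "FObj F () = FObj G ()"
  shows "F = G"
  by (rule functor_eqI[OF F G])
    (use functor_simps(7)[OF F, of "()"] functor_simps(7)[OF G, of "()"] assms(3)
      in \<open>auto simp: one_simps\<close>)

text \<open>A functor out of the interval is the same as an isomorphism, so the lifting condition on
  functors is the elementary one on isomorphisms.\<close>

lemma iso_fibration_iff:
  assumes F: "is_functor F A B"
  shows "iso_fibration F \<longleftrightarrow> (\<forall>a\<in>Obj A. \<forall>g. iso B g \<longrightarrow> Dom B g = FObj F a \<longrightarrow>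
    (\<exists>f. iso A f \<and> Dom A f = a \<and> FArr F f = g))" (is "_ \<longleftrightarrow> ?R")
proof
  have A: "category A" and B: "category B" using functor_cats[OF F] by auto
  note s = functor_simps[OF F] comp_simps one_simps interval_simps end0_simps
    functor_simps[OF is_functor_end0]
  show ?R if L: "iso_fibration F"
  proof (intro ballI allI impI)
    fix a g assume a: "a \<in> Obj A" and g: "iso B g" "Dom B g = FObj F a"
    obtain H where H: "is_functor H interval B" "FArr H (False, True) = g"
      using path_exists[OF B g(1)] .
    let ?a = "const_functor one_cat A a"
    have a': "is_functor ?a one_cat A" by (rule is_functor_const[OF category_one A a])
    have "H \<circ>\<^sub>F end0 = F \<circ>\<^sub>F ?a"
      by (rule one_functor_eqI[OF is_functor_comp[OF is_functor_end0 H(1)] is_functor_comp[OF a' F]])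
        (use functor_simps(5)[OF H(1), of "(False, True)"] g H(2)
          in \<open>simp add: s functor_simps[OF a'], simp add: const_simps one_simps\<close>)
    then obtain l where l: "is_functor l interval A" "l \<circ>\<^sub>F end0 = ?a" "F \<circ>\<^sub>F l = H"
      using L a' H(1) unfolding iso_fibration_def by (auto simp: s)
    have "FObj l False = a"
      using l(2) comp_simps(3)[of "()" end0 l]
      by (simp add: s) (simp add: const_simps one_simps)
    moreover have "FArr F (FArr l (False, True)) = g"
      using H(2) l(3) comp_simps(4)[of "(False, True)" l F] by (auto simp: s functor_simps[OF l(1)])
    moreover have "Dom A (FArr l (False, True)) = FObj l False"
      by (simp add: functor_simps[OF l(1)] s)
    ultimately show "\<exists>f. iso A f \<and> Dom A f = a \<and> FArr F f = g"
      using functor_iso(1)[OF l(1) iso_interval] by blast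
  qed
  show "iso_fibration F" if R: ?R
    unfolding iso_fibration_def s
  proof (intro conjI allI impI)
    fix a g assume a: "is_functor a one_cat A" and g: "is_functor g interval B"
      and eq: "g \<circ>\<^sub>F end0 = F \<circ>\<^sub>F a"
    have ao: "FObj a () \<in> Obj A" using functor_simps(3)[OF a] by (simp add: s)
    have go: "FObj g False = FObj F (FObj a ())"
      using comp_eqD(1)[OF eq, of one_cat "()"] by (simp add: s functor_simps[OF a])
    obtain f where f: "iso A f" "Dom A f = FObj a ()" "FArr F f = FArr g (False, True)"
      using R ao functor_iso(1)[OF g iso_interval, of "(False, True)"] go
        functor_simps(5)[OF g, of "(False, True)"] by (auto simp: s)
    obtain l where l: "is_functor l interval A" "FArr l (False, True) = f"
      using path_exists[OF A f(1)] .
    have "F \<circ>\<^sub>F l = g"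
      by (rule interval_functor_eqI[OF is_functor_comp[OF l(1) F] g])
        (simp add: s functor_simps[OF l(1)] l(2) f)
    moreover have "l \<circ>\<^sub>F end0 = a"
      by (rule one_functor_eqI[OF is_functor_comp[OF is_functor_end0 l(1)] a])
        (use functor_simps(5)[OF l(1), of "(False, True)"] l(2) f(2) in \<open>simp add: s\<close>)
    ultimately show "\<exists>l. is_functor l interval A \<and> l \<circ>\<^sub>F end0 = a \<and> F \<circ>\<^sub>F l = g"
      using l(1) by blast
  qed (rule F)
qed

section \<open>Lifting\<close>

text \<open>Essential surjectivity gives an isomorphism from \<open>F a\<close> to \<open>b\<close>; its lift ends over \<open>b\<close> itself.\<close>

lemma trivial_fibration_surj:
  assumes F: "is_functor F A B" and "iso_fibration F" and "essentially_surjective F A B"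
    and b: "b \<in> Obj B"
  shows "\<exists>a\<in>Obj A. FObj F a = b"
proof -
  obtain a g where a: "a \<in> Obj A" and g: "iso B g" "Dom B g = FObj F a" "Cod B g = b"
    using assms(3) b unfolding essentially_surjective_def by blast
  obtain f where f: "iso A f" "FArr F f = g"
    using assms(2)[unfolded iso_fibration_iff[OF F]] a g by blast
  have "FObj F (Cod A f) = b"
    using g(3) f(2) functor_simps(6)[OF F] iso_simps(1)[OF f(1)] by force
  then show ?thesis
    using category_simps(2)[OF functor_cats(1)[OF F]] iso_simps(1)[OF f(1)] by blast
qed

text \<open>Injectivity of \<open>i\<close> and surjectivity of \<open>p\<close> solve the lifting problem on objects; full
  faithfulness of \<open>p\<close> then forces the solution on arrows.\<close>

lemma lift_against_trivial_fibration:
  assumes i: "is_functor i A B" and inj: "inj_on (FObj i) (Obj A)"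
    and p: "fully_faithful p E D" and surj: "\<And>d. d \<in> Obj D \<Longrightarrow> \<exists>e\<in>Obj E. FObj p e = d"
    and u: "is_functor u A E" and v: "is_functor v B D" and sq: "p \<circ>\<^sub>F u = v \<circ>\<^sub>F i"
  shows "\<exists>l. is_functor l B E \<and> l \<circ>\<^sub>F i = u \<and> p \<circ>\<^sub>F l = v"
proof -
  note p' = ff_functor[OF p]
  note A = functor_cats(1)[OF u]
  note s = functor_simps[OF i] functor_simps[OF p'] functor_simps[OF u] functor_simps[OF v]
    comp_simps category_simps[OF A]
  note sqD = comp_eqD[OF sq functor_simps(1)[OF u] functor_simps(1)[OF i]]
  have "\<exists>e\<in>Obj E. FObj p e = FObj v b \<and> (\<forall>a\<in>Obj A. FObj i a = b \<longrightarrow> e = FObj u a)"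
    if b: "b \<in> Obj B" for b
  proof (cases "\<exists>a\<in>Obj A. FObj i a = b")
    case True
    then obtain a where a: "a \<in> Obj A" "FObj i a = b" by blast
    then show ?thesis using inj sqD(1)[OF a(1)]
      by (intro bexI[of _ "FObj u a"]) (auto simp: s inj_on_def)
  next
    case False
    then show ?thesis using surj[of "FObj v b"] b by (auto simp: s)
  qed
  then obtain ob where ob: "\<And>b. b \<in> Obj B \<Longrightarrow> ob b \<in> Obj E"
    "\<And>b. b \<in> Obj B \<Longrightarrow> FObj p (ob b) = FObj v b"
    "\<And>b a. b \<in> Obj B \<Longrightarrow> a \<in> Obj A \<Longrightarrow> FObj i a = b \<Longrightarrow> ob b = FObj u a"
    by metis
  obtain l where l: "is_functor l B E" "\<And>b. b \<in> Obj B \<Longrightarrow> FObj l b = ob b" "p \<circ>\<^sub>F l = v"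
    by (rule ff_lift[OF p v ob(1,2)]) blast+
  have "l \<circ>\<^sub>F i = u"
  proof (rule functor_eqI[OF is_functor_comp[OF i l(1)] u])
    fix f assume f: "f \<in> Arr A"
    have "FArr p (FArr l (FArr i f)) = FArr v (FArr i f)"
      using l(3) comp_simps(4)[of "FArr i f" l p] f by (simp add: s functor_simps[OF l(1)])
    then show "FArr (l \<circ>\<^sub>F i) f = FArr u f"
      using sqD(2)[OF f] f
      by (intro ff_faithful[OF p]) (auto simp: s functor_simps[OF l(1)] l(2) ob(3))
  qed
  with l show ?thesis by blast
qed

text \<open>A trivial cofibration has a retraction, homotopic to the identity relative to its domain.
  The iso-fibration transports the composite of \<open>u\<close> with this retraction along the image of the
  homotopy. The lifted isomorphisms are identities on the image of \<open>i\<close>, so the transported functor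
  still extends \<open>u\<close>.\<close>

lemma trivial_cofibration_lift:
  assumes i: "fully_faithful i A B" and inj: "inj_on (FObj i) (Obj A)"
    and es: "essentially_surjective i A B"
    and p: "is_functor p E D" and fib: "iso_fibration p"
    and u: "is_functor u A E" and v: "is_functor v B D" and sq: "p \<circ>\<^sub>F u = v \<circ>\<^sub>F i"
  shows "\<exists>l. is_functor l B E \<and> l \<circ>\<^sub>F i = u \<and> p \<circ>\<^sub>F l = v"
proof -
  note i' = ff_functor[OF i]
  note A = functor_cats(1)[OF u] and B = functor_cats(1)[OF v] and E = functor_cats(1)[OF p]
    and D = functor_cats(2)[OF p]
  note s = functor_simps[OF i'] functor_simps[OF p] functor_simps[OF u] functor_simps[OF v]
    comp_simps category_simps[OF A] category_simps[OF B]
  note sqD = comp_eqD[OF sq functor_simps(1)[OF u] functor_simps(1)[OF i']]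
  define Q where "Q b a t \<longleftrightarrow> a \<in> Obj A \<and> iso B t \<and> Dom B t = FObj i a \<and> Cod B t = b \<and>
      (\<forall>a'\<in>Obj A. FObj i a' = b \<longrightarrow> a = a' \<and> t = Idn B b)" for b a t
  have "\<exists>a t. Q b a t" if b: "b \<in> Obj B" for b
  proof (cases "\<exists>a\<in>Obj A. FObj i a = b")
    case True
    then obtain a where a: "a \<in> Obj A" "FObj i a = b" by blast
    then show ?thesis using inj b unfolding Q_def
      by (intro exI[of _ a] exI[of _ "Idn B b"]) (auto simp: s inj_on_def iso_Idn[OF B])
  next
    case False
    obtain a t where "a \<in> Obj A" "iso B t" "Dom B t = FObj i a" "Cod B t = b"
      using es b unfolding essentially_surjective_def by blast
    with False show ?thesis unfolding Q_def by blast
  qed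
  then obtain ob t where Q: "\<And>b. b \<in> Obj B \<Longrightarrow> Q b (ob b) (t b)" by metis
  then have ob: "\<And>b. b \<in> Obj B \<Longrightarrow> ob b \<in> Obj A"
    and t: "\<And>b. b \<in> Obj B \<Longrightarrow> iso B (t b)" "\<And>b. b \<in> Obj B \<Longrightarrow> Dom B (t b) = FObj i (ob b)"
      "\<And>b. b \<in> Obj B \<Longrightarrow> Cod B (t b) = b"
    and oi: "\<And>b a. b \<in> Obj B \<Longrightarrow> a \<in> Obj A \<Longrightarrow> FObj i a = b \<Longrightarrow> ob b = a \<and> t b = Idn B b"
    unfolding Q_def by blast+
  have obi: "ob (FObj i a) = a" "t (FObj i a) = Idn B (FObj i a)" if "a \<in> Obj A" for a
    using oi[of "FObj i a" a] functor_simps(3)[OF i' that] that by auto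
  note s2 = s t(2,3) iso_simps[OF t(1)] iso_cancel[OF B t(1)] ob obi
  have "\<exists>g. iso E g \<and> Dom E g = FObj u (ob b) \<and> FArr p g = FArr v (t b) \<and>
      (b \<in> FObj i ` Obj A \<longrightarrow> g = Idn E (FObj u (ob b)))" if b: "b \<in> Obj B" for b
  proof (cases "b \<in> FObj i ` Obj A")
    case True
    then show ?thesis
      using sqD(1) by (auto intro!: exI[of _ "Idn E (FObj u (ob b))"] iso_Idn[OF E]
          simp: s2 category_simps[OF E])
  next
    case False
    have "iso D (FArr v (t b))" "Dom D (FArr v (t b)) = FObj p (FObj u (ob b))"
      using functor_iso(1)[OF v t(1)[OF b]] sqD(1)[OF ob[OF b]] b by (auto simp: s2)
    then show ?thesis
      using fib[unfolded iso_fibration_iff[OF p], rule_format, of "FObj u (ob b)"] False b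
      by (auto simp: s2)
  qed
  then obtain w where w: "\<And>b. b \<in> Obj B \<Longrightarrow> iso E (w b)"
    "\<And>b. b \<in> Obj B \<Longrightarrow> Dom E (w b) = FObj u (ob b)"
    "\<And>b. b \<in> Obj B \<Longrightarrow> FArr p (w b) = FArr v (t b)"
    and wo: "\<And>b. b \<in> Obj B \<Longrightarrow> b \<in> FObj i ` Obj A \<Longrightarrow> w b = Idn E (FObj u (ob b))"
    by metis
  have wi: "w (FObj i a) = Idn E (FObj u a)" if "a \<in> Obj A" for a
    using wo[of "FObj i a"] that by (simp add: s2)
  note I = is_functor_id[OF B]
  let ?M = "twist (id_functor B) (\<lambda>b. cinv B (t b))"
  have M: "is_functor ?M B B"
    by (rule is_functor_twist[OF I]) (simp_all add: iso_cinv iso_simps t id_simps)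
  have cc: "cinv B (cinv B (t b)) = t b" if "b \<in> Obj B" for b
    by (rule cinv_unique[OF B]) (simp_all add: iso_simps t that)
  obtain r where r: "is_functor r B A" and rob: "\<And>b. b \<in> Obj B \<Longrightarrow> FObj r b = ob b"
    and ir: "i \<circ>\<^sub>F r = ?M"
    by (rule ff_lift[OF i M ob]) (auto simp: twist_simps[OF I] iso_simps t)
  note s3 = s2 functor_simps[OF r] rob cc
  have irf: "FArr i (FArr r f) = Cmp B (cinv B (t (Cod B f))) (Cmp B f (t (Dom B f)))"
    if "f \<in> Arr B" for f
  proof -
    have "FArr i (FArr r f) = FArr ?M f" using that by (simp add: ir[symmetric] s3)
    then show ?thesis using that by (simp add: twist_simps[OF I] id_simps s3)
  qed
  have ri: "FArr r (FArr i f) = f" if f: "f \<in> Arr A" for f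
    by (rule ff_faithful[OF i])
      (use f in \<open>simp_all add: s3 irf cinv_Idn[OF B]\<close>)
  note ur = is_functor_comp[OF r u]
  let ?l = "twist (u \<circ>\<^sub>F r) w"
  have l: "is_functor ?l B E"
    by (rule is_functor_twist[OF ur]) (simp_all add: w s3)
  have "?l \<circ>\<^sub>F i = u"
    by (rule functor_eqI[OF is_functor_comp[OF i' l] u])
      (simp add: s3 twist_simps[OF ur] ri wi cinv_Idn[OF E] category_simps[OF E])
  moreover have "p \<circ>\<^sub>F ?l = v"
  proof (rule functor_eqI[OF is_functor_comp[OF l p] v])
    fix f assume f: "f \<in> Arr B"
    have vt: "cinv D (FArr v (t b)) = FArr v (cinv B (t b))" "cinv D (FArr p (w b)) = FArr p (cinv E (w b))"
      if "b \<in> Obj B" for b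
      using functor_iso(2)[OF v t(1)[OF that]] functor_iso(2)[OF p w(1)[OF that]] .
    have pw: "FArr p (cinv E (w b)) = FArr v (cinv B (t b))" if "b \<in> Obj B" for b
      using vt[OF that] w(3)[OF that] by simp
    have "FArr (p \<circ>\<^sub>F ?l) f = FArr p (Cmp E (w (Cod B f)) (Cmp E (FArr u (FArr r f)) (cinv E (w (Dom B f)))))"
      using f by (simp add: functor_simps[OF l] comp_simps twist_simps[OF ur] s3)
    also have "\<dots> = Cmp D (FArr v (t (Cod B f))) (Cmp D (FArr v (FArr i (FArr r f))) (FArr v (cinv B (t (Dom B f)))))"
      using f by (simp add: s3 w iso_simps[OF w(1)] category_simps[OF E] pw sqD(2))
    also have "\<dots> = FArr v (Cmp B (t (Cod B f)) (Cmp B (FArr i (FArr r f)) (cinv B (t (Dom B f)))))"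
      using f by (simp add: s3)
    also have "\<dots> = FArr v f"
      using f by (simp only: irf) (simp add: s3)
    finally show "FArr (p \<circ>\<^sub>F ?l) f = FArr v f" .
  qed
  ultimately show ?thesis using l by blast
qed

section \<open>Factorisations\<close>

text \<open>The category over \<open>A\<close> that is fully faithful over it with object map \<open>\<phi>\<close>. The same arrow of
  \<open>A\<close> may occur with several sources and targets in \<open>S\<close>, so an arrow has to record them. The
  injection \<open>e\<close> encodes the triple, which allows the result to have the same carrier types as \<open>A\<close>.\<close>

definition reindexed ::
    "('p \<times> 'm \<times> 'p \<Rightarrow> 'n) \<Rightarrow> 'p set \<Rightarrow> ('p \<Rightarrow> 'o) \<Rightarrow> ('o, 'm) cat \<Rightarrow> ('p, 'n) cat" where
  "reindexed e S \<phi> A = \<lparr>Obj = S,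
     Arr = e ` {(s, f, t). s \<in> S \<and> t \<in> S \<and> f \<in> Arr A \<and> Dom A f = \<phi> s \<and> Cod A f = \<phi> t},
     Dom = (\<lambda>x. fst (inv e x)), Cod = (\<lambda>x. snd (snd (inv e x))),
     Idn = (\<lambda>s. e (s, Idn A (\<phi> s), s)),
     Cmp = (\<lambda>y x. e (fst (inv e x), Cmp A (fst (snd (inv e y))) (fst (snd (inv e x))),
       snd (snd (inv e y))))\<rparr>"

definition reindexed_proj ::
    "('p \<times> 'm \<times> 'p \<Rightarrow> 'n) \<Rightarrow> 'p set \<Rightarrow> ('p \<Rightarrow> 'o) \<Rightarrow> ('o, 'm) cat \<Rightarrow> ('p, 'n, 'o, 'm) func" where
  "reindexed_proj e S \<phi> A = \<lparr>FDom = reindexed e S \<phi> A, FCod = A, FObj = (\<lambda>s\<in>S. \<phi> s),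
     FArr = (\<lambda>x\<in>Arr (reindexed e S \<phi> A). fst (snd (inv e x)))\<rparr>"

lemma reindexed_Obj: "Obj (reindexed e S \<phi> A) = S"
  by (simp add: reindexed_def)

lemma reindexed_proj_Obj: "s \<in> S \<Longrightarrow> FObj (reindexed_proj e S \<phi> A) s = \<phi> s"
  by (simp add: reindexed_proj_def)

lemma category_reindexed:
  assumes "inj e" "category A" "\<And>s. s \<in> S \<Longrightarrow> \<phi> s \<in> Obj A"
  shows "category (reindexed e S \<phi> A)"
  unfolding category_def reindexed_def
  by (auto simp: inv_f_f[OF assms(1)] category_simps[OF assms(2)] assms(3))

lemma reindexed_proj_ff:
  assumes e: "inj e" and A: "category A" and \<phi>: "\<And>s. s \<in> S \<Longrightarrow> \<phi> s \<in> Obj A"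
  shows "fully_faithful (reindexed_proj e S \<phi> A) (reindexed e S \<phi> A) A"
proof -
  let ?R = "reindexed e S \<phi> A" and ?P = "reindexed_proj e S \<phi> A"
  note R = category_reindexed[of e A S \<phi>, OF assms]
  note s = inv_f_f[OF e] category_simps[OF A] \<phi>
  have P: "is_functor ?P ?R A"
    using R A unfolding is_functor_def
    by (auto simp: reindexed_def reindexed_proj_def s)
  have "\<exists>f\<in>Arr ?R. Dom ?R f = a \<and> Cod ?R f = b \<and> FArr ?P f = g"
    if "a \<in> S" "b \<in> S" "g \<in> Arr A" "Dom A g = \<phi> a" "Cod A g = \<phi> b" for a b g
    using that by (intro bexI[of _ "e (a, g, b)"]) (auto simp: reindexed_def reindexed_proj_def s)
  moreover have "f = g" if "f \<in> Arr ?R" "g \<in> Arr ?R" "Dom ?R f = Dom ?R g" "Cod ?R f = Cod ?R g"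
    "FArr ?P f = FArr ?P g" for f g
    using that by (auto simp: reindexed_def reindexed_proj_def s)
  ultimately show ?thesis
    using P unfolding fully_faithful_def by (auto simp: reindexed_Obj reindexed_proj_Obj)
qed

lemma groupoid_reindexed:
  assumes e: "inj e" and A: "groupoid A" and \<phi>: "\<And>s. s \<in> S \<Longrightarrow> \<phi> s \<in> Obj A"
  shows "groupoid (reindexed e S \<phi> A)"
proof -
  let ?R = "reindexed e S \<phi> A" and ?P = "reindexed_proj e S \<phi> A"
  have A': "category A" using A by (simp add: groupoid_def)
  note ff = reindexed_proj_ff[of e A S \<phi>, OF e A' \<phi>]
  note s = functor_simps[OF ff_functor[OF ff]] category_simps[OF functor_cats(1)[OF ff_functor[OF ff]]]
  have "iso ?R f" if f: "f \<in> Arr ?R" for f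
  proof -
    have "iso A (FArr ?P f)" using A f by (simp add: groupoid_def s)
    then have "\<exists>g. iso ?R g \<and> Dom ?R g = Dom ?R f \<and> Cod ?R g = Cod ?R f \<and> FArr ?P g = FArr ?P f"
      by - (rule ff_full_iso[OF ff, of "Dom ?R f" "Cod ?R f" "FArr ?P f"]; auto simp: s f)
    then obtain g where g: "iso ?R g" "Dom ?R g = Dom ?R f" "Cod ?R g = Cod ?R f"
      "FArr ?P g = FArr ?P f" by blast
    have "g = f" using ff_faithful[OF ff _ f] g by (simp add: iso_simps)
    then show ?thesis using g by simp
  qed
  then show ?thesis using category_reindexed[of e A S \<phi>, OF e A' \<phi>] by (simp add: groupoid_def)
qed

text \<open>If the two sets are not both finite, their product is no larger than their disjoint union.\<close>

lemma card_of_Times_ordLess: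
  assumes \<kappa>: "Cinfinite \<kappa>" and AB: "(card_of A, \<kappa>) \<in> ordLess" "(card_of B, \<kappa>) \<in> ordLess"
  shows "(card_of (A \<times> B), \<kappa>) \<in> ordLess"
proof -
  have k: "\<not> finite (Field \<kappa>)" "Card_order \<kappa>" using \<kappa> by (simp_all add: cinfinite_def)
  show ?thesis
  proof (cases "finite (A <+> B)")
    case True
    then have "finite (Field (card_of (A \<times> B)))" by (simp add: Field_card_of)
    then show ?thesis
      by (rule finite_ordLess_infinite[OF card_of_Well_order card_order_on_well_order_on[OF k(2)] _ k(1)])
  next
    case False
    have "(card_of (A \<times> B), card_of (A <+> B)) \<in> ordLeq"
      by (rule card_of_Times_ordLeq_infinite_Field
          [OF _ card_of_Plus1 card_of_Plus2 card_of_Card_order])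
        (simp only: Field_card_of False not_False_eq_True)
    moreover have "(card_of (A <+> B), \<kappa>) \<in> ordLess"
      using AB k by (intro card_of_Plus_ordLess_infinite_Field)
    ultimately show ?thesis by (rule ordLeq_ordLess_trans)
  qed
qed

lemma small_reindexed:
  assumes \<kappa>: "Cinfinite \<kappa>" and A: "small \<kappa> A" and S: "(card_of S, \<kappa>) \<in> ordLess"
  shows "small \<kappa> (reindexed e S \<phi> A)"
proof -
  have "(card_of (S \<times> Arr A \<times> S), \<kappa>) \<in> ordLess"
    using A S by (intro card_of_Times_ordLess[OF \<kappa>]) (auto simp: small_def)
  moreover have "(card_of (Arr (reindexed e S \<phi> A)), card_of (S \<times> Arr A \<times> S)) \<in> ordLeq"
    using card_of_image[of e "{(s, f, t). s \<in> S \<and> t \<in> S \<and> f \<in> Arr A \<and> Dom A f = \<phi> s \<and> Cod A f = \<phi> t}"]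
      card_of_mono1[of "{(s, f, t). s \<in> S \<and> t \<in> S \<and> f \<in> Arr A \<and> Dom A f = \<phi> s \<and> Cod A f = \<phi> t}"
        "S \<times> Arr A \<times> S"]
    by (auto simp: reindexed_def intro: ordLeq_transitive)
  ultimately show ?thesis
    using S ordLeq_ordLess_trans unfolding small_def reindexed_Obj by blast
qed

lemma surj_imp_es:
  assumes F: "is_functor F A B" and "\<And>b. b \<in> Obj B \<Longrightarrow> \<exists>a\<in>Obj A. FObj F a = b"
  shows "essentially_surjective F A B"
  unfolding essentially_surjective_def
proof
  fix b assume b: "b \<in> Obj B"
  note B = functor_cats(2)[OF F]
  show "\<exists>a\<in>Obj A. \<exists>f. iso B f \<and> Dom B f = FObj F a \<and> Cod B f = b"
    using assms(2)[OF b] iso_Idn[OF B b] category_simps(4,5)[OF B b] by blast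
qed

lemma equivalence_id:
  assumes "category A"
  shows "equivalence (id_functor A)"
proof (rule ff_es_imp_equivalence)
  show "fully_faithful (id_functor A) A A"
    using is_functor_id[OF assms] by (auto simp: fully_faithful_def id_simps)
  show "essentially_surjective (id_functor A) A A"
    by (rule surj_imp_es[OF is_functor_id[OF assms]]) (auto simp: id_simps)
qed

text \<open>The common ground of \<open>Cat \<kappa>\<close> and \<open>Grpd \<kappa>\<close>. Closure under reindexing is what puts the middle
  objects of both factorisations into \<open>S\<close>.\<close>

locale reindexing_closed =
  fixes \<kappa> :: "'k rel" and S :: "'u smallcat set"
  assumes inf: "infinite (UNIV :: 'u set)" and \<kappa>: "Cinfinite \<kappa>"
    and category_S: "A \<in> S \<Longrightarrow> category A" and small_S: "A \<in> S \<Longrightarrow> small \<kappa> A"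
    and reindexed_S: "A \<in> S \<Longrightarrow> inj e \<Longrightarrow> (\<And>t. t \<in> T \<Longrightarrow> \<phi> t \<in> Obj A) \<Longrightarrow>
      (card_of T, \<kappa>) \<in> ordLess \<Longrightarrow> reindexed e T \<phi> A \<in> S"
begin

lemma pair_code: obtains e :: "'u \<times> 'u \<Rightarrow> 'u" where "inj e"
proof -
  have "(card_of ((UNIV :: 'u set) \<times> (UNIV :: 'u set)), card_of (UNIV :: 'u set)) \<in> ordLeq"
    by (rule ordIso_imp_ordLeq[OF card_of_Times_same_infinite[OF inf]])
  then have "\<exists>e :: 'u \<times> 'u \<Rightarrow> 'u. inj e" by (simp add: card_of_ordLeq[symmetric])
  then show ?thesis using that by blast
qed

lemma sum_code: obtains e :: "'u + 'u \<Rightarrow> 'u" where "inj e"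
proof -
  have "(card_of ((UNIV :: 'u set) <+> (UNIV :: 'u set)), card_of (UNIV :: 'u set)) \<in> ordLeq"
    by (rule ordIso_imp_ordLeq[OF card_of_Plus_infinite1[OF inf ordIso_imp_ordLeq[OF card_of_refl]]])
  then have "\<exists>e :: 'u + 'u \<Rightarrow> 'u. inj e" by (simp add: card_of_ordLeq[symmetric])
  then show ?thesis using that by blast
qed

lemma triple_code: obtains e :: "'u \<times> 'u \<times> 'u \<Rightarrow> 'u" where "inj e"
proof -
  obtain d :: "'u \<times> 'u \<Rightarrow> 'u" where "inj d" by (rule pair_code)
  then have "inj (\<lambda>(x, y, z). d (x, d (y, z)))"
    by (intro injI) (auto dest: injD)
  then show ?thesis by (rule that)
qed

text \<open>The middle object has the objects of both categories. Those of \<open>A\<close> make \<open>i\<close> injective, those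
  of \<open>B\<close> make \<open>p\<close> surjective, and taking all hom-sets in \<open>B\<close> makes \<open>p\<close> fully faithful.\<close>

lemma factor_inj_trivial_fibration:
  assumes F: "is_functor F A B" and AB: "A \<in> S" "B \<in> S"
  obtains E i p where "E \<in> S" "is_functor i A E" "inj_on (FObj i) (Obj A)"
    "fully_faithful p E B" "\<And>b. b \<in> Obj B \<Longrightarrow> \<exists>x\<in>Obj E. FObj p x = b" "p \<circ>\<^sub>F i = F"
proof -
  obtain d :: "'u + 'u \<Rightarrow> 'u" where d: "inj d" by (rule sum_code)
  obtain e :: "'u \<times> 'u \<times> 'u \<Rightarrow> 'u" where e: "inj e" by (rule triple_code)
  define T where "T = d ` (Obj A <+> Obj B)"
  define \<phi> where "\<phi> x = (case inv d x of Inl a \<Rightarrow> FObj F a | Inr b \<Rightarrow> b)" for x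
  have \<phi>: "\<phi> t \<in> Obj B" if "t \<in> T" for t
    using that by (auto simp: T_def \<phi>_def inv_f_f[OF d] functor_simps[OF F])
  have c: "(card_of (Obj A <+> Obj B), \<kappa>) \<in> ordLess"
    using small_S[OF AB(1)] small_S[OF AB(2)] \<kappa>
    by (intro card_of_Plus_ordLess_infinite_Field) (auto simp: small_def cinfinite_def)
  have T: "(card_of T, \<kappa>) \<in> ordLess"
    unfolding T_def by (rule ordLeq_ordLess_trans[OF card_of_image c])
  let ?E = "reindexed e T \<phi> B" and ?p = "reindexed_proj e T \<phi> B"
  have E: "?E \<in> S" by (rule reindexed_S[OF AB(2) e \<phi> T])
  have p: "fully_faithful ?p ?E B"
    by (rule reindexed_proj_ff[OF e functor_cats(2)[OF F] \<phi>])
  have o: "d (Inl a) \<in> T \<and> \<phi> (d (Inl a)) = FObj F a" if "a \<in> Obj A" for a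
    using that by (auto simp: T_def \<phi>_def inv_f_f[OF d])
  obtain i where i: "is_functor i A ?E" "\<And>a. a \<in> Obj A \<Longrightarrow> FObj i a = d (Inl a)" "?p \<circ>\<^sub>F i = F"
    by (rule ff_lift[OF p F, of "\<lambda>a. d (Inl a)"])
      (use o in \<open>auto simp: reindexed_Obj reindexed_proj_Obj\<close>)
  have inj: "inj_on (FObj i) (Obj A)"
    by (rule inj_onI) (auto simp: i(2) inj_eq[OF d])
  have surj: "\<exists>x\<in>Obj ?E. FObj ?p x = b" if b: "b \<in> Obj B" for b
  proof (rule bexI[of _ "d (Inr b)"])
    show T: "d (Inr b) \<in> Obj ?E" using b by (auto simp: T_def reindexed_Obj)
    then show "FObj ?p (d (Inr b)) = b"
      by (simp add: reindexed_Obj reindexed_proj_Obj) (simp add: \<phi>_def inv_f_f[OF d])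
  qed
  show ?thesis by (rule that[OF E i(1) inj p surj i(3)])
qed

text \<open>The mapping path category: its objects are pairs \<open>(a, t)\<close> with \<open>t\<close> an isomorphism out of
  \<open>F a\<close>. An arrow is determined by its component in \<open>A\<close>, so the category is reindexed from \<open>A\<close>, and
  the target functor is \<open>F\<close> conjugated by the isomorphisms \<open>t\<close>.\<close>

lemma factor_trivial_cofibration_fibration:
  assumes F: "is_functor F A B" and AB: "A \<in> S" "B \<in> S"
  obtains E i p where "E \<in> S" "is_functor i A E" "inj_on (FObj i) (Obj A)" "equivalence i"
    "is_functor p E B" "iso_fibration p" "p \<circ>\<^sub>F i = F"
proof -
  note A = functor_cats(1)[OF F] and B = functor_cats(2)[OF F]
  obtain d :: "'u \<times> 'u \<Rightarrow> 'u" where d: "inj d" by (rule pair_code)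
  obtain e :: "'u \<times> 'u \<times> 'u \<Rightarrow> 'u" where e: "inj e" by (rule triple_code)
  define P where "P = {(a, t). a \<in> Obj A \<and> iso B t \<and> Dom B t = FObj F a}"
  define T where "T = d ` P"
  define \<phi> where "\<phi> x = fst (inv d x)" for x
  define \<tau> where "\<tau> x = snd (inv d x)" for x
  have \<phi>: "\<phi> x \<in> Obj A" and \<tau>: "iso B (\<tau> x)" "Dom B (\<tau> x) = FObj F (\<phi> x)" if x: "x \<in> T" for x
  proof -
    obtain a t where "x = d (a, t)" "a \<in> Obj A" "iso B t" "Dom B t = FObj F a"
      using x unfolding T_def P_def by blast
    then show "\<phi> x \<in> Obj A" "iso B (\<tau> x)" "Dom B (\<tau> x) = FObj F (\<phi> x)"
      by (simp_all add: \<phi>_def \<tau>_def inv_f_f[OF d])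
  qed
  have dT: "d (a, t) \<in> T" "\<phi> (d (a, t)) = a" "\<tau> (d (a, t)) = t"
    if "a \<in> Obj A" "iso B t" "Dom B t = FObj F a" for a t
    using that by (simp_all add: T_def P_def \<phi>_def \<tau>_def inv_f_f[OF d])
  have c: "(card_of (Obj A \<times> Arr B), \<kappa>) \<in> ordLess"
    using small_S[OF AB(1)] small_S[OF AB(2)]
    by (intro card_of_Times_ordLess[OF \<kappa>]) (auto simp: small_def)
  have "(card_of P, card_of (Obj A \<times> Arr B)) \<in> ordLeq"
    by (rule card_of_mono1) (auto simp: P_def iso_def)
  then have T: "(card_of T, \<kappa>) \<in> ordLess"
    unfolding T_def
    by (intro ordLeq_ordLess_trans[OF card_of_image] ordLeq_ordLess_trans[OF _ c])
  let ?E = "reindexed e T \<phi> A" and ?q = "reindexed_proj e T \<phi> A"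
  have E: "?E \<in> S" by (rule reindexed_S[OF AB(1) e \<phi> T])
  have q: "fully_faithful ?q ?E A"
    by (rule reindexed_proj_ff[OF e A \<phi>])
  note q' = ff_functor[OF q]
  have unit: "d (a, Idn B (FObj F a)) \<in> T" "\<phi> (d (a, Idn B (FObj F a))) = a"
    "\<tau> (d (a, Idn B (FObj F a))) = Idn B (FObj F a)" if "a \<in> Obj A" for a
    using dT[OF that iso_Idn[OF B]] that by (simp_all add: functor_simps[OF F] category_simps[OF B])
  have qe: "equivalence ?q"
    by (rule ff_es_imp_equivalence[OF q surj_imp_es[OF q']])
      (use unit in \<open>auto simp: reindexed_Obj reindexed_proj_Obj intro!: bexI\<close>)
  obtain i where i: "is_functor i A ?E" "\<And>a. a \<in> Obj A \<Longrightarrow> FObj i a = d (a, Idn B (FObj F a))"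
    "?q \<circ>\<^sub>F i = id_functor A"
    by (rule ff_lift[OF q is_functor_id[OF A], of "\<lambda>a. d (a, Idn B (FObj F a))"])
      (use unit in \<open>auto simp: reindexed_Obj reindexed_proj_Obj id_simps\<close>)
  have inj: "inj_on (FObj i) (Obj A)"
    by (rule inj_onI) (auto simp: i(2) inj_eq[OF d])
  have ie: "equivalence i"
    by (rule equivalence_comp(3)[OF i(1) q' qe]) (simp add: i(3) equivalence_id[OF A])
  note Fq = is_functor_comp[OF q' F]
  let ?p = "twist (F \<circ>\<^sub>F ?q) \<tau>"
  note E' = functor_cats(1)[OF q']
  note s = functor_simps[OF F] functor_simps[OF q'] functor_simps[OF i(1)] comp_simps
    category_simps[OF B] category_simps[OF E'] category_simps[OF A] reindexed_Obj reindexed_proj_Obj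
  have p: "is_functor ?p ?E B"
    by (rule is_functor_twist[OF Fq]) (simp_all add: s \<tau>)
  have qi: "FArr ?q (FArr i f) = f" if "f \<in> Arr A" for f
    using i(3) that comp_simps(4)[of f i ?q] by (simp add: s id_simps)
  have pi: "?p \<circ>\<^sub>F i = F"
    by (rule functor_eqI[OF is_functor_comp[OF i(1) p] F])
      (simp add: s twist_simps[OF Fq] i(2) unit qi cinv_Idn[OF B])
  have fib: "iso_fibration ?p"
    unfolding iso_fibration_iff[OF p]
  proof (intro ballI allI impI)
    fix x g assume x: "x \<in> Obj ?E" and g: "iso B g" "Dom B g = FObj ?p x"
    have xT: "x \<in> T" using x by (simp add: s)
    note sx = s \<tau>[OF xT] \<phi>[OF xT] iso_simps[OF \<tau>(1)[OF xT]] iso_simps[OF g(1)]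
    have g': "Dom B g = Cod B (\<tau> x)" using g x by (simp add: twist_simps[OF Fq])
    let ?t = "Cmp B g (\<tau> x)"
    have t: "iso B ?t" "Dom B ?t = FObj F (\<phi> x)"
      using iso_Cmp[OF B \<tau>(1)[OF xT] g(1)] g' by (simp_all add: sx)
    note y = dT[OF \<phi>[OF xT] t]
    \<comment> \<open>Over the identity in \<open>A\<close>, changing the isomorphism from \<open>t\<close> to \<open>g t\<close> is an arrow lying over \<open>g\<close>.\<close>
    obtain f where f: "iso ?E f" "Dom ?E f = x" "Cod ?E f = d (\<phi> x, ?t)"
      "FArr ?q f = Idn A (\<phi> x)"
      by (rule ff_full_iso[OF q, of x "d (\<phi> x, ?t)" "Idn A (\<phi> x)"])
        (use xT y in \<open>auto simp: sx iso_Idn[OF A]\<close>)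
    have "FArr ?p f = g"
      using f iso_simps(1)[OF f(1)] g' xT y by (simp add: twist_simps[OF Fq] sx)
    then show "\<exists>f. iso ?E f \<and> Dom ?E f = x \<and> FArr ?p f = g" using f by blast
  qed
  show ?thesis by (rule that[OF E i(1) inj ie p fib pi])
qed

end

section \<open>Cofibrations are the functors injective on objects\<close>

lemma prod_simps:
  "Obj (A \<times>\<^sub>C B) = Obj A \<times> Obj B" "Arr (A \<times>\<^sub>C B) = Arr A \<times> Arr B"
  "Dom (A \<times>\<^sub>C B) (f, g) = (Dom A f, Dom B g)" "Cod (A \<times>\<^sub>C B) (f, g) = (Cod A f, Cod B g)"
  "Idn (A \<times>\<^sub>C B) (a, b) = (Idn A a, Idn B b)"
  "Cmp (A \<times>\<^sub>C B) (f, g) (f', g') = (Cmp A f f', Cmp B g g')"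
  by (simp_all add: prod_cat_def)

lemma category_prod:
  assumes "category A" "category B"
  shows "category (A \<times>\<^sub>C B)"
  unfolding category_def by (auto simp: prod_simps category_simps[OF assms(1)] category_simps[OF assms(2)])

lemma iso_prod:
  assumes A: "category A" and B: "category B" and f: "iso A f" and g: "iso B g"
  shows "iso (A \<times>\<^sub>C B) (f, g)" "cinv (A \<times>\<^sub>C B) (f, g) = (cinv A f, cinv B g)"
proof -
  show "iso (A \<times>\<^sub>C B) (f, g)"
    by (rule isoI[of _ _ "(cinv A f, cinv B g)"]) (simp_all add: prod_simps iso_simps[OF f] iso_simps[OF g])
  show "cinv (A \<times>\<^sub>C B) (f, g) = (cinv A f, cinv B g)"
    by (rule cinv_unique[OF category_prod[OF A B]])
      (simp_all add: prod_simps iso_simps[OF f] iso_simps[OF g])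
qed

lemma is_functor_cyl0:
  assumes "category A" shows "is_functor (cyl0 A) A (A \<times>\<^sub>C interval)"
  using assms category_prod[OF assms category_interval] unfolding is_functor_def
  by (auto simp: cyl0_def prod_simps interval_simps end0_simps category_simps[OF assms])

lemma cyl0_simps:
  "a \<in> Obj A \<Longrightarrow> FObj (cyl0 A) a = (a, False)" "f \<in> Arr A \<Longrightarrow> FArr (cyl0 A) f = (f, (False, False))"
  by (simp_all add: cyl0_def end0_simps)

lemma is_functor_cyl_proj:
  assumes "category A" shows "is_functor (cyl_proj A) (A \<times>\<^sub>C interval) A"
  using assms category_prod[OF assms category_interval] unfolding is_functor_def
  by (auto simp: cyl_proj_def prod_simps interval_simps category_simps[OF assms])

lemma cyl_proj_simps:
  "a \<in> Obj A \<Longrightarrow> FObj (cyl_proj A) (a, x) = a" "f \<in> Arr A \<Longrightarrow> FArr (cyl_proj A) (f, p) = f"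
  by (simp_all add: cyl_proj_def prod_simps interval_simps)

lemma is_functor_prod:
  assumes F: "is_functor F A B" and G: "is_functor G C D"
  shows "is_functor (F \<times>\<^sub>F G) (A \<times>\<^sub>C C) (B \<times>\<^sub>C D)"
  using category_prod[OF functor_cats(1)[OF F] functor_cats(1)[OF G]]
    category_prod[OF functor_cats(2)[OF F] functor_cats(2)[OF G]]
  unfolding is_functor_def
  by (auto simp: prod_functor_def prod_simps functor_simps[OF F] functor_simps[OF G]
      category_simps[OF functor_cats(1)[OF F]] category_simps[OF functor_cats(1)[OF G]])

lemma prod_cyl_simps:
  assumes "is_functor F A B"
  shows "a \<in> Obj A \<Longrightarrow> FObj (F \<times>\<^sub>F id_functor interval) (a, x) = (FObj F a, x)"
    "f \<in> Arr A \<Longrightarrow> FArr (F \<times>\<^sub>F id_functor interval) (f, p) = (FArr F f, p)"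
  by (simp_all add: prod_functor_def prod_simps functor_simps[OF assms] id_functor_def interval_simps)

lemma twist_cong:
  assumes "category (FDom F)" and "\<And>a. a \<in> Obj (FDom F) \<Longrightarrow> t a = t' a"
  shows "twist F t = twist F t'"
  using assms by (auto simp: twist_def category_simps intro!: restrict_ext)

text \<open>Since \<open>j\<close> is injective on objects, a homotopy starting at \<open>g \<circ> j\<close> prescribes at most one
  isomorphism out of each object \<open>g b\<close>. Taking identities at the remaining objects and conjugating
  \<open>g\<close> gives the extension. The choice is natural, as functors preserve identities, and normal, as a
  constant homotopy prescribes identities.\<close>

lemma inj_imp_normally_cloven:
  fixes j :: "'u smallfunc"
  assumes jK: "j \<in> Arr K" and j: "is_functor j A B" and inj: "inj_on (FObj j) (Obj A)"
  shows "normally_cloven_iso_cofibration K j"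
proof -
  note A = functor_cats(1)[OF j] and B = functor_cats(2)[OF j]
  note BI = category_prod[OF B category_interval]
  note prA = is_functor_cyl_proj[OF A] and prB = is_functor_cyl_proj[OF B]
  define j' where "j' = inv_into (Obj A) (FObj j)"
  have j': "j' (FObj j a) = a" if "a \<in> Obj A" for a
    using inj that by (simp add: j'_def)
  define \<theta> :: "'u smallfunc \<Rightarrow> ('u \<times> bool, 'u \<times> (bool \<times> bool), 'u, 'u) func \<Rightarrow> 'u \<times> bool \<Rightarrow> 'u"
    where "\<theta> g h y = (if snd y \<and> fst y \<in> FObj j ` Obj A
      then FArr h (Idn A (j' (fst y)), (False, True)) else Idn (FCod g) (FObj g (fst y)))" for g h y
  define k where "k X g h = twist (g \<circ>\<^sub>F cyl_proj B) (\<theta> g h)"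
    for X :: "'u smallcat" and g :: "'u smallfunc"
      and h :: "('u \<times> bool, 'u \<times> (bool \<times> bool), 'u, 'u) func"
  note s = functor_simps[OF j] functor_simps[OF prA] functor_simps[OF prB] comp_simps
    category_simps[OF A] category_simps[OF B] prod_simps interval_simps cyl0_simps cyl_proj_simps
    prod_cyl_simps[OF j]
  have ext: "(\<forall>y\<in>Obj (B \<times>\<^sub>C interval). iso X (\<theta> g h y) \<and>
        Dom X (\<theta> g h y) = FObj (g \<circ>\<^sub>F cyl_proj B) y) \<and>
      is_functor (k X g h) (B \<times>\<^sub>C interval) X \<and>
      k X g h \<circ>\<^sub>F (j \<times>\<^sub>F id_functor interval) = h \<and> k X g h \<circ>\<^sub>F cyl0 B = g"
    if ep: "extension_problem j X g h" for X g h
  proof -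
    have g: "is_functor g B X" and h: "is_functor h (A \<times>\<^sub>C interval) X"
      and h0: "h \<circ>\<^sub>F cyl0 A = g \<circ>\<^sub>F j"
      using ep by (auto simp: extension_problem_def s)
    note X = functor_cats(2)[OF g]
    note G = is_functor_comp[OF prB g]
    note s1 = s functor_simps[OF g] functor_simps[OF h] functor_simps[OF is_functor_cyl0[OF A]]
    note h0D = comp_eqD[OF h0 functor_simps(1)[OF is_functor_cyl0[OF A]] functor_simps(1)[OF j]]
    have hob: "FObj h (a, False) = FObj g (FObj j a)" if "a \<in> Obj A" for a
      using h0D(1)[OF that] that by (simp add: s1)
    have har: "FArr h (f, (False, False)) = FArr g (FArr j f)" if "f \<in> Arr A" for f
      using h0D(2)[OF that] that by (simp add: s1)
    have iso: "iso X (FArr h (Idn A a, p))" "cinv X (FArr h (Idn A a, p)) = FArr h (Idn A a, (snd p, fst p))"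
      if "a \<in> Obj A" for a p
      using functor_iso[OF h iso_prod(1)[OF A category_interval iso_Idn[OF A that] iso_interval[of p]]]
        iso_prod(2)[OF A category_interval iso_Idn[OF A that] iso_interval[of p]]
        cinv_interval[of "fst p" "snd p"] cinv_Idn[OF A that] by auto
    have t: "iso X (\<theta> g h y)" "Dom X (\<theta> g h y) = FObj (g \<circ>\<^sub>F cyl_proj B) y"
      if "y \<in> Obj (B \<times>\<^sub>C interval)" for y
      using that by (cases y; auto simp: \<theta>_def s1 iso j' hob iso_Idn[OF X] category_simps[OF X])+
    have tj: "\<theta> g h (FObj j a, x) = FArr h (Idn A a, (False, x))" if "a \<in> Obj A" for a x
      using that har[of "Idn A a"] by (cases x) (auto simp: \<theta>_def s1 j')
    have kf: "is_functor (k X g h) (B \<times>\<^sub>C interval) X"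
      unfolding k_def by (rule is_functor_twist[OF G t])
    have "k X g h \<circ>\<^sub>F (j \<times>\<^sub>F id_functor interval) = h"
    proof (rule functor_eqI[OF is_functor_comp[OF is_functor_prod[OF j is_functor_id[OF category_interval]] kf] h])
      fix z assume z: "z \<in> Arr (A \<times>\<^sub>C interval)"
      obtain f x y where zf: "z = (f, (x, y))" by (cases z) auto
      have f: "f \<in> Arr A" using z zf by (simp add: s)
      \<comment> \<open>Every arrow of the cylinder goes down to the base, along \<open>f\<close> there, and up again.\<close>
      let ?c = "\<lambda>z. Cmp (A \<times>\<^sub>C interval) (Idn A (Cod A f), (False, y))
        (Cmp (A \<times>\<^sub>C interval) (f, (False, False)) z)"
      have "FArr (k X g h \<circ>\<^sub>F (j \<times>\<^sub>F id_functor interval)) z =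
          Cmp X (FArr h (Idn A (Cod A f), (False, y)))
            (Cmp X (FArr h (f, (False, False))) (FArr h (Idn A (Dom A f), (x, False))))"
        using f by (simp add: zf k_def s1 twist_simps[OF G] tj iso har
            functor_simps[OF is_functor_prod[OF j is_functor_id[OF category_interval]]])
      also have "\<dots> = FArr h (?c (Idn A (Dom A f), (x, False)))"
        using f functor_simps(8)[OF h, of "(Idn A (Dom A f), (x, False))" "(f, (False, False))"]
          functor_simps(8)[OF h, of "(f, (x, False))" "(Idn A (Cod A f), (False, y))"]
        by (simp add: s1)
      also have "?c (Idn A (Dom A f), (x, False)) = z"
        using f by (simp add: zf s1)
      finally show "FArr (k X g h \<circ>\<^sub>F (j \<times>\<^sub>F id_functor interval)) z = FArr h z" .
    qed
    moreover have "k X g h \<circ>\<^sub>F cyl0 B = g"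
      by (rule functor_eqI[OF is_functor_comp[OF is_functor_cyl0[OF B] kf] g])
        (simp add: k_def s1 functor_simps[OF is_functor_cyl0[OF B]] twist_simps[OF G] \<theta>_def
          cinv_Idn[OF X] category_simps[OF X])
    ultimately show ?thesis using t kf by blast
  qed
  have norm: "k X g (g \<circ>\<^sub>F j \<circ>\<^sub>F cyl_proj A) = g \<circ>\<^sub>F cyl_proj B" if g: "is_functor g B X" for X g
  proof -
    note X = functor_cats(2)[OF g]
    note G = is_functor_comp[OF prB g]
    note s1 = s functor_simps[OF g]
    have "\<theta> g (g \<circ>\<^sub>F j \<circ>\<^sub>F cyl_proj A) y = Idn X (FObj (g \<circ>\<^sub>F cyl_proj B) y)"
      if "y \<in> Obj (B \<times>\<^sub>C interval)" for y
      using that by (cases y) (auto simp: \<theta>_def s1 j')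
    then show ?thesis unfolding k_def
      by (intro twist_eqI[OF G G])
        (auto simp: s1 category_simps[OF X] iso_Idn[OF X])
  qed
  have nat: "g' \<circ>\<^sub>F k X g h = k Y (g' \<circ>\<^sub>F g) (g' \<circ>\<^sub>F h)"
    if ep: "extension_problem j X g h" and g': "is_functor g' X Y" for X Y g h g'
  proof -
    have g: "is_functor g B X" and h: "is_functor h (A \<times>\<^sub>C interval) X"
      using ep by (auto simp: extension_problem_def s)
    note G = is_functor_comp[OF prB g]
    have "g' \<circ>\<^sub>F k X g h = twist (g' \<circ>\<^sub>F (g \<circ>\<^sub>F cyl_proj B)) (\<lambda>y. FArr g' (\<theta> g h y))"
      unfolding k_def using ext[OF ep] by (intro comp_twist[OF G g']) auto
    also have "g' \<circ>\<^sub>F (g \<circ>\<^sub>F cyl_proj B) = g' \<circ>\<^sub>F g \<circ>\<^sub>F cyl_proj B"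
      by (rule comp_assoc[OF prB g g'])
    also have "twist (g' \<circ>\<^sub>F g \<circ>\<^sub>F cyl_proj B) (\<lambda>y. FArr g' (\<theta> g h y)) = k Y (g' \<circ>\<^sub>F g) (g' \<circ>\<^sub>F h)"
      unfolding k_def
    proof (rule twist_cong)
      show "category (FDom (g' \<circ>\<^sub>F g \<circ>\<^sub>F cyl_proj B))" using BI by (simp add: s)
      fix y assume "y \<in> Obj (FDom (g' \<circ>\<^sub>F g \<circ>\<^sub>F cyl_proj B))"
      then show "FArr g' (\<theta> g h y) = \<theta> (g' \<circ>\<^sub>F g) (g' \<circ>\<^sub>F h) y"
        by (cases y) (auto simp: \<theta>_def s functor_simps[OF g] functor_simps[OF h] functor_simps[OF g'] j')
    qed
    finally show ?thesis .
  qed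
  show ?thesis
    unfolding normally_cloven_iso_cofibration_def functor_simps(1,2)[OF j]
    using jK ext norm nat by (intro conjI exI[of _ k]) blast+
qed

text \<open>Factor \<open>j\<close> as \<open>p \<circ> i\<close> with \<open>i\<close> injective on objects and \<open>p\<close> a surjective equivalence, and
  choose a section \<open>s\<close> of \<open>p\<close>. Then \<open>s \<circ> j\<close> is isomorphic to \<open>i\<close>. Extending this homotopy along \<open>j\<close>
  makes the object map of \<open>i\<close> factor through that of \<open>j\<close>.\<close>

lemma (in reindexing_closed) normally_cloven_imp_inj:
  assumes j: "is_functor j A B" and AB: "A \<in> S" "B \<in> S"
    and nc: "normally_cloven_iso_cofibration (functor_category S) j"
  shows "inj_on (FObj j) (Obj A)"
proof -
  note A = functor_cats(1)[OF j] and B = functor_cats(2)[OF j]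
  obtain E i p where E: "E \<in> S" and i: "is_functor i A E" and inj: "inj_on (FObj i) (Obj A)"
    and p: "fully_faithful p E B" and surj: "\<And>b. b \<in> Obj B \<Longrightarrow> \<exists>x\<in>Obj E. FObj p x = b"
    and pi: "p \<circ>\<^sub>F i = j"
    using factor_inj_trivial_fibration[OF j AB] by blast
  note p' = ff_functor[OF p]
  note CE = functor_cats(1)[OF p']
  obtain ob where ob: "\<And>b. b \<in> Obj B \<Longrightarrow> ob b \<in> Obj E" "\<And>b. b \<in> Obj B \<Longrightarrow> FObj p (ob b) = b"
    using surj by metis
  obtain \<sigma> where \<sigma>: "is_functor \<sigma> B E" "\<And>b. b \<in> Obj B \<Longrightarrow> FObj \<sigma> b = ob b"
    by (rule ff_lift[OF p is_functor_id[OF B] ob(1)]) (auto simp: ob id_simps)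
  note s = functor_simps[OF j] functor_simps[OF i] functor_simps[OF p'] functor_simps[OF \<sigma>(1)]
    category_simps[OF A] category_simps[OF B] comp_simps prod_simps interval_simps cyl0_simps
    cyl_proj_simps prod_cyl_simps[OF j] \<sigma>(2)
  have piob: "FObj p (FObj i a) = FObj j a" if "a \<in> Obj A" for a
    using pi that comp_simps(3)[of a i p] by (simp add: s)
  have "\<exists>t. iso E t \<and> Dom E t = ob (FObj j a) \<and> Cod E t = FObj i a" if a: "a \<in> Obj A" for a
    by (rule ff_full_iso[OF p, of "ob (FObj j a)" "FObj i a" "Idn B (FObj j a)"])
      (use a in \<open>auto simp: s ob piob iso_Idn[OF B]\<close>)
  then obtain t where t: "\<And>a. a \<in> Obj A \<Longrightarrow> iso E (t a)" "\<And>a. a \<in> Obj A \<Longrightarrow> Dom E (t a) = ob (FObj j a)"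
    "\<And>a. a \<in> Obj A \<Longrightarrow> Cod E (t a) = FObj i a" by metis
  note prA = is_functor_cyl_proj[OF A]
  note \<sigma>j = is_functor_comp[OF j \<sigma>(1)]
  note G = is_functor_comp[OF prA \<sigma>j]
  note c0 = is_functor_cyl0[OF A]
  define u where "u y = (if snd y then t (fst y) else Idn E (ob (FObj j (fst y))))" for y :: "'u \<times> bool"
  define h where "h = twist (\<sigma> \<circ>\<^sub>F j \<circ>\<^sub>F cyl_proj A) u"
  have h: "is_functor h (A \<times>\<^sub>C interval) E"
    unfolding h_def
    by (rule is_functor_twist[OF G])
      (auto simp: u_def t s functor_simps[OF prA] iso_Idn[OF CE] category_simps[OF CE] ob)
  have "h \<circ>\<^sub>F cyl0 A = \<sigma> \<circ>\<^sub>F j"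
    by (rule functor_eqI[OF is_functor_comp[OF c0 h] \<sigma>j])
      (simp add: h_def u_def twist_simps[OF G] s functor_simps[OF prA] functor_simps[OF c0]
        cinv_Idn[OF CE] category_simps[OF CE] ob)
  then have ep: "extension_problem j E \<sigma> h"
    using \<sigma>(1) h by (simp add: extension_problem_def s)
  have "\<exists>k. is_functor k (B \<times>\<^sub>C interval) E \<and> k \<circ>\<^sub>F (j \<times>\<^sub>F id_functor interval) = h"
    using nc E ep unfolding normally_cloven_iso_cofibration_def
    by (auto simp: functor_category_def functor_simps[OF j])
  then obtain k where k: "k \<circ>\<^sub>F (j \<times>\<^sub>F id_functor interval) = h" by blast
  note jI = is_functor_prod[OF j is_functor_id[OF category_interval]]
  have "FObj k (FObj j a, True) = FObj i a" if a: "a \<in> Obj A" for a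
  proof -
    have "FObj k (FObj j a, True) = FObj h (a, True)"
      using a by (simp add: k[symmetric] s functor_simps[OF jI])
    also have "\<dots> = FObj i a"
      using a by (simp add: h_def twist_simps[OF G] s u_def t)
    finally show ?thesis .
  qed
  then show ?thesis using inj unfolding inj_on_def by metis
qed

section \<open>The model structure\<close>

text \<open>The section \<open>b\<close> carries data over \<open>F\<close> to data over \<open>G\<close>, where it lifts along the equivalence
  \<open>G\<close>; the retraction \<open>r\<close> brings the lift back.\<close>

lemma equivalence_retract:
  assumes F: "is_functor F A B" and G: "is_functor G C D" and Ge: "equivalence G"
    and a: "is_functor a A C" and r: "is_functor r C A" and ra: "r \<circ>\<^sub>F a = id_functor A"
    and b: "is_functor b B D" and s: "is_functor s D B" and sb: "s \<circ>\<^sub>F b = id_functor B"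
    and sq1: "G \<circ>\<^sub>F a = b \<circ>\<^sub>F F" and sq2: "F \<circ>\<^sub>F r = s \<circ>\<^sub>F G"
  shows "equivalence F"
proof -
  have Gff: "fully_faithful G C D" and Ges: "essentially_surjective G C D"
    using equivalence_imp_ff_es[OF G Ge] .
  note f = functor_simps[OF F] functor_simps[OF G] functor_simps[OF a] functor_simps[OF r]
    functor_simps[OF b] functor_simps[OF s] comp_simps
  note sq1D = comp_eqD[OF sq1 functor_simps(1)[OF a] functor_simps(1)[OF F]]
  note sq2D = comp_eqD[OF sq2 functor_simps(1)[OF r] functor_simps(1)[OF G]]
  have raD: "FArr r (FArr a h) = h" if "h \<in> Arr A" for h
    using ra that comp_simps(4)[of h a r] by (simp add: f id_simps)
  have raO: "FObj r (FObj a x) = x" if "x \<in> Obj A" for x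
    using ra that comp_simps(3)[of x a r] by (simp add: f id_simps)
  have sbD: "FArr s (FArr b h) = h" if "h \<in> Arr B" for h
    using sb that comp_simps(4)[of h b s] by (simp add: f id_simps)
  have sbO: "FObj s (FObj b x) = x" if "x \<in> Obj B" for x
    using sb that comp_simps(3)[of x b s] by (simp add: f id_simps)
  have "\<exists>h\<in>Arr A. Dom A h = x \<and> Cod A h = y \<and> FArr F h = g"
    if xy: "x \<in> Obj A" "y \<in> Obj A" and g: "g \<in> Arr B" "Dom B g = FObj F x" "Cod B g = FObj F y"
    for x y g
  proof -
    obtain w where w: "w \<in> Arr C" "Dom C w = FObj a x" "Cod C w = FObj a y" "FArr G w = FArr b g"
      by (rule ff_full[OF Gff, of "FObj a x" "FObj a y" "FArr b g"])
        (use xy g sq1D(1) in \<open>auto simp: f\<close>)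
    have "FArr F (FArr r w) = g" using sq2D(2)[OF w(1)] w(4) sbD[OF g(1)] by simp
    then show ?thesis using w xy raO by (intro bexI[of _ "FArr r w"]) (auto simp: f)
  qed
  moreover have "g = h" if gh: "g \<in> Arr A" "h \<in> Arr A" "Dom A g = Dom A h" "Cod A g = Cod A h"
    "FArr F g = FArr F h" for g h
  proof -
    have "FArr G (FArr a g) = FArr G (FArr a h)"
      using sq1D(2)[OF gh(1)] sq1D(2)[OF gh(2)] gh(5) by simp
    then have "FArr a g = FArr a h"
      using gh(1-4) by (intro ff_faithful[OF Gff]) (simp_all add: functor_simps[OF a])
    then have "FArr r (FArr a g) = FArr r (FArr a h)" by (rule arg_cong)
    then show ?thesis unfolding raD[OF gh(1)] raD[OF gh(2)] .
  qed
  ultimately have ff: "fully_faithful F A B"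
    using F unfolding fully_faithful_def by blast
  have "essentially_surjective F A B"
    unfolding essentially_surjective_def
  proof
    fix y assume y: "y \<in> Obj B"
    then have "FObj b y \<in> Obj D" by (simp add: f)
    then obtain c h where c: "c \<in> Obj C" "iso D h" "Dom D h = FObj G c" "Cod D h = FObj b y"
      using Ges unfolding essentially_surjective_def by blast
    have "iso B (FArr s h)" "Dom B (FArr s h) = FObj F (FObj r c)" "Cod B (FArr s h) = y"
      using functor_iso(1)[OF s c(2)] iso_simps(1)[OF c(2)] c sq2D(1)[OF c(1)] sbO[OF y]
      by (simp_all add: f)
    then show "\<exists>a\<in>Obj A. \<exists>f. iso B f \<and> Dom B f = FObj F a \<and> Cod B f = y"
      using functor_simps(3)[OF r c(1)] by blast
  qed
  with ff show ?thesis by (rule ff_es_imp_equivalence)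
qed

lemma iso_fibration_retract:
  assumes p: "is_functor p A B" and j: "is_functor j A E" and r: "is_functor r E A"
    and rj: "r \<circ>\<^sub>F j = id_functor A" and q: "is_functor q E B" and qf: "iso_fibration q"
    and qj: "q \<circ>\<^sub>F j = p" and pr: "p \<circ>\<^sub>F r = q"
  shows "iso_fibration p"
  unfolding iso_fibration_iff[OF p]
proof (intro ballI allI impI)
  note f = functor_simps[OF p] functor_simps[OF q] functor_simps[OF j] functor_simps[OF r] comp_simps
  fix a g assume a: "a \<in> Obj A" and g: "iso B g" "Dom B g = FObj p a"
  have "FObj p a = FObj q (FObj j a)" using a by (simp add: qj[symmetric] f)
  then obtain h where h: "iso E h" "Dom E h = FObj j a" "FArr q h = g"
    using qf[unfolded iso_fibration_iff[OF q], rule_format, of "FObj j a" g] g a by (auto simp: f)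
  have "FObj r (FObj j a) = a"
    using rj a comp_simps(3)[of a j r] by (simp add: f id_simps)
  moreover have "FArr p (FArr r h) = FArr q h"
    using iso_simps(1)[OF h(1)] comp_simps(4)[of h r p] by (simp add: f pr)
  ultimately show "\<exists>f. iso A f \<and> Dom A f = a \<and> FArr p f = g"
    using functor_iso(1)[OF r h(1)] h(2,3) iso_simps(1)[OF h(1)]
    by (intro exI[of _ "FArr r h"]) (simp add: f)
qed

context reindexing_closed
begin

abbreviation \<K> :: "('u smallcat, 'u smallfunc) cat" where
  "\<K> \<equiv> functor_category S"

lemma \<K>_simps: "Obj \<K> = S" "Dom \<K> = FDom" "Cod \<K> = FCod" "Idn \<K> = id_functor" "Cmp \<K> = (\<circ>\<^sub>F)"
  by (simp_all add: functor_category_def)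

lemma \<K>_Arr: "F \<in> Arr \<K> \<longleftrightarrow> FDom F \<in> S \<and> FCod F \<in> S \<and> is_functor F (FDom F) (FCod F)"
  by (auto simp: functor_category_def functor_simps)

lemma category_\<K>: "category \<K>"
  unfolding category_def
proof (intro conjI ballI impI)
  fix F assume "F \<in> Arr \<K>"
  then show "Dom \<K> F \<in> Obj \<K>" "Cod \<K> F \<in> Obj \<K>"
    "Cmp \<K> F (Idn \<K> (Dom \<K> F)) = F" "Cmp \<K> (Idn \<K> (Cod \<K> F)) F = F"
    by (auto simp: \<K>_Arr \<K>_simps comp_id)
next
  fix A assume "A \<in> Obj \<K>"
  then show "Idn \<K> A \<in> Arr \<K>" "Dom \<K> (Idn \<K> A) = A" "Cod \<K> (Idn \<K> A) = A"
    using is_functor_id[OF category_S] by (auto simp: \<K>_Arr \<K>_simps id_simps)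
next
  fix F G assume "F \<in> Arr \<K>" "G \<in> Arr \<K>" "Cod \<K> F = Dom \<K> G"
  then show "Cmp \<K> G F \<in> Arr \<K>" "Dom \<K> (Cmp \<K> G F) = Dom \<K> F" "Cod \<K> (Cmp \<K> G F) = Cod \<K> G"
    using is_functor_comp[of F "FDom F" "FCod F" G "FCod G"]
    by (auto simp: \<K>_Arr \<K>_simps comp_simps)
next
  fix F G H assume "F \<in> Arr \<K>" "G \<in> Arr \<K>" "H \<in> Arr \<K>" "Cod \<K> F = Dom \<K> G" "Cod \<K> G = Dom \<K> H"
  then show "Cmp \<K> H (Cmp \<K> G F) = Cmp \<K> (Cmp \<K> H G) F"
    using comp_assoc[of F "FDom F" "FCod F" G "FCod G" H "FCod H"] by (simp add: \<K>_Arr \<K>_simps)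
qed

lemma lifts_iff:
  assumes i: "is_functor i A B" and p: "is_functor p E D"
    and "A \<in> S" "B \<in> S" "E \<in> S" "D \<in> S"
  shows "lifts \<K> i p \<longleftrightarrow> (\<forall>u v. is_functor u A E \<longrightarrow> is_functor v B D \<longrightarrow> p \<circ>\<^sub>F u = v \<circ>\<^sub>F i \<longrightarrow>
    (\<exists>l. is_functor l B E \<and> l \<circ>\<^sub>F i = u \<and> p \<circ>\<^sub>F l = v))"
proof -
  have arr: "F \<in> Arr \<K> \<and> FDom F = X \<and> FCod F = Y \<longleftrightarrow> is_functor F X Y"
    if "X \<in> S" "Y \<in> S" for F X Y
    using that functor_simps(1,2)[of F X Y] by (auto simp: \<K>_Arr)
  show ?thesis
    unfolding lifts_def \<K>_simps functor_simps(1,2)[OF i] functor_simps(1,2)[OF p]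
    using arr[OF assms(3,5)] arr[OF assms(4,6)] arr[OF assms(4,5)] by blast
qed

lemma cofibration_iff:
  assumes "F \<in> Arr \<K>"
  shows "normally_cloven_iso_cofibration \<K> F \<longleftrightarrow> inj_on (FObj F) (Obj (FDom F))"
  using assms inj_imp_normally_cloven[OF assms] normally_cloven_imp_inj
  by (auto simp: \<K>_Arr)

definition "\<W> = {F \<in> Arr \<K>. equivalence F}"
definition "\<F> = {F \<in> Arr \<K>. iso_fibration F}"
definition "\<C> = {F \<in> Arr \<K>. normally_cloven_iso_cofibration \<K> F}"

lemma \<C>_alt: "\<C> = {F \<in> Arr \<K>. inj_on (FObj F) (Obj (FDom F))}"
  using cofibration_iff by (auto simp: \<C>_def)

lemma cofibration_lifts:
  assumes i: "i \<in> \<C>" and p: "p \<in> \<F> \<inter> \<W>"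
  shows "lifts \<K> i p"
proof -
  have i': "is_functor i (FDom i) (FCod i)" "inj_on (FObj i) (Obj (FDom i))"
    and iS: "FDom i \<in> S" "FCod i \<in> S" using i by (auto simp: \<C>_alt \<K>_Arr)
  have p': "is_functor p (FDom p) (FCod p)" and pf: "iso_fibration p" and pe: "equivalence p"
    and pS: "FDom p \<in> S" "FCod p \<in> S" using p by (auto simp: \<F>_def \<W>_def \<K>_Arr)
  note pff = equivalence_imp_ff_es[OF p' pe]
  show ?thesis
    unfolding lifts_iff[OF i'(1) p' iS pS]
    using lift_against_trivial_fibration[OF i' pff(1) trivial_fibration_surj[OF p' pf pff(2)]]
    by blast
qed

lemma trivial_cofibration_lifts:
  assumes i: "i \<in> \<C> \<inter> \<W>" and p: "p \<in> \<F>"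
  shows "lifts \<K> i p"
proof -
  have i': "is_functor i (FDom i) (FCod i)" "inj_on (FObj i) (Obj (FDom i))" and ie: "equivalence i"
    and iS: "FDom i \<in> S" "FCod i \<in> S" using i by (auto simp: \<C>_alt \<W>_def \<K>_Arr)
  have p': "is_functor p (FDom p) (FCod p)" and pf: "iso_fibration p"
    and pS: "FDom p \<in> S" "FCod p \<in> S" using p by (auto simp: \<F>_def \<K>_Arr)
  note iff = equivalence_imp_ff_es[OF i'(1) ie]
  show ?thesis
    unfolding lifts_iff[OF i'(1) p' iS pS]
    using trivial_cofibration_lift[OF iff(1) i'(2) iff(2) p' pf] by blast
qed

lemma cofibration_trivial_fibration_factorisation:
  assumes "F \<in> Arr \<K>"
  obtains E i p where "E \<in> S" "is_functor i (FDom F) E" "is_functor p E (FCod F)" "p \<circ>\<^sub>F i = F"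
    "i \<in> \<C>" "p \<in> \<F> \<inter> \<W>"
proof -
  have F: "is_functor F (FDom F) (FCod F)" and S: "FDom F \<in> S" "FCod F \<in> S"
    using assms by (auto simp: \<K>_Arr)
  obtain E i p where E: "E \<in> S" and i: "is_functor i (FDom F) E" "inj_on (FObj i) (Obj (FDom F))"
    and p: "fully_faithful p E (FCod F)"
    and surj: "\<And>b. b \<in> Obj (FCod F) \<Longrightarrow> \<exists>x\<in>Obj E. FObj p x = b" and pi: "p \<circ>\<^sub>F i = F"
    using factor_inj_trivial_fibration[OF F S] by blast
  note p' = ff_functor[OF p]
  have pe: "equivalence p"
    by (rule ff_es_imp_equivalence[OF p surj_imp_es[OF p' surj]])
  have pf: "iso_fibration p"
    unfolding iso_fibration_iff[OF p']
  proof (intro ballI allI impI)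
    fix a g assume a: "a \<in> Obj E" and g: "iso (FCod F) g" "Dom (FCod F) g = FObj p a"
    have "Cod (FCod F) g \<in> Obj (FCod F)"
      using category_simps(2)[OF functor_cats(2)[OF F] iso_simps(1)[OF g(1)]] .
    then obtain b where b: "b \<in> Obj E" "FObj p b = Cod (FCod F) g" using surj by blast
    show "\<exists>f. iso E f \<and> Dom E f = a \<and> FArr p f = g"
      by (rule ff_full_iso[OF p a b(1) g b(2)[symmetric]]) blast
  qed
  show ?thesis
    by (rule that[OF E i(1) p' pi])
      (use E S i p' pe pf in \<open>auto simp: \<C>_alt \<F>_def \<W>_def \<K>_Arr functor_simps[OF i(1)] functor_simps[OF p']\<close>)
qed

lemma trivial_cofibration_fibration_factorisation:
  assumes "F \<in> Arr \<K>"
  obtains E i p where "E \<in> S" "is_functor i (FDom F) E" "is_functor p E (FCod F)" "p \<circ>\<^sub>F i = F"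
    "i \<in> \<C> \<inter> \<W>" "p \<in> \<F>"
proof -
  have F: "is_functor F (FDom F) (FCod F)" and S: "FDom F \<in> S" "FCod F \<in> S"
    using assms by (auto simp: \<K>_Arr)
  obtain E i p where E: "E \<in> S" and i: "is_functor i (FDom F) E" "inj_on (FObj i) (Obj (FDom F))"
    "equivalence i" and p: "is_functor p E (FCod F)" "iso_fibration p" and pi: "p \<circ>\<^sub>F i = F"
    using factor_trivial_cofibration_fibration[OF F S] by blast
  show ?thesis
    by (rule that[OF E i(1) p(1) pi])
      (use E S i p in \<open>auto simp: \<C>_alt \<F>_def \<W>_def \<K>_Arr functor_simps[OF i(1)] functor_simps[OF p(1)]\<close>)
qed

text \<open>The retract argument: an arrow lifting against the second factor of its own factorisation is
  a retract of the first factor, and dually.\<close>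

lemma llp_retract:
  assumes f: "f \<in> Arr \<K>" and E: "E \<in> S" and i: "is_functor i (FDom f) E"
    and p: "is_functor p E (FCod f)" and pi: "p \<circ>\<^sub>F i = f" and l: "lifts \<K> f p"
  obtains s where "is_functor s (FCod f) E" "s \<circ>\<^sub>F f = i" "p \<circ>\<^sub>F s = id_functor (FCod f)"
proof -
  have F: "is_functor f (FDom f) (FCod f)" and S: "FDom f \<in> S" "FCod f \<in> S"
    using f by (auto simp: \<K>_Arr)
  have "p \<circ>\<^sub>F i = id_functor (FCod f) \<circ>\<^sub>F f" using pi comp_id(2)[OF F] by simp
  then show ?thesis
    using l[unfolded lifts_iff[OF F p S E S(2)]] i is_functor_id[OF category_S[OF S(2)]] that by blast
qed

lemma rlp_retract:
  assumes f: "f \<in> Arr \<K>" and E: "E \<in> S" and i: "is_functor i (FDom f) E"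
    and p: "is_functor p E (FCod f)" and pi: "p \<circ>\<^sub>F i = f" and l: "lifts \<K> i f"
  obtains r where "is_functor r E (FDom f)" "r \<circ>\<^sub>F i = id_functor (FDom f)" "f \<circ>\<^sub>F r = p"
proof -
  have F: "is_functor f (FDom f) (FCod f)" and S: "FDom f \<in> S" "FCod f \<in> S"
    using f by (auto simp: \<K>_Arr)
  have "f \<circ>\<^sub>F id_functor (FDom f) = p \<circ>\<^sub>F i" using pi comp_id(1)[OF F] by simp
  then show ?thesis
    using l[unfolded lifts_iff[OF i F S(1) E S]] p is_functor_id[OF category_S[OF S(1)]] that by blast
qed

lemma inj_cancel:
  assumes f: "is_functor f A B" and "s \<circ>\<^sub>F f = i" and "inj_on (FObj i) (Obj A)"
  shows "inj_on (FObj f) (Obj A)"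
proof (rule inj_onI)
  fix a b assume ab: "a \<in> Obj A" "b \<in> Obj A" "FObj f a = FObj f b"
  then have "FObj i a = FObj i b"
    unfolding assms(2)[symmetric] by (simp add: comp_simps functor_simps(1)[OF f])
  then show "a = b" using inj_onD[OF assms(3)] ab by blast
qed

lemma fibrations_eq: "\<F> = rlp \<K> (\<C> \<inter> \<W>)"
proof
  show "\<F> \<subseteq> rlp \<K> (\<C> \<inter> \<W>)"
    using trivial_cofibration_lifts by (auto simp: rlp_def \<F>_def)
  show "rlp \<K> (\<C> \<inter> \<W>) \<subseteq> \<F>"
  proof
    fix f assume "f \<in> rlp \<K> (\<C> \<inter> \<W>)"
    then have f: "f \<in> Arr \<K>" and l: "\<And>i. i \<in> \<C> \<inter> \<W> \<Longrightarrow> lifts \<K> i f" by (auto simp: rlp_def)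
    have F: "is_functor f (FDom f) (FCod f)" using f by (auto simp: \<K>_Arr)
    obtain E i p where fac: "E \<in> S" "is_functor i (FDom f) E" "is_functor p E (FCod f)"
      "p \<circ>\<^sub>F i = f" "i \<in> \<C> \<inter> \<W>" "p \<in> \<F>" by (rule trivial_cofibration_fibration_factorisation[OF f])
    obtain r where r: "is_functor r E (FDom f)" "r \<circ>\<^sub>F i = id_functor (FDom f)" "f \<circ>\<^sub>F r = p"
      by (rule rlp_retract[OF f fac(1-4) l[OF fac(5)]])
    have "iso_fibration p" using fac(6) by (simp add: \<F>_def)
    then have "iso_fibration f"
      by (rule iso_fibration_retract[OF F fac(2) r(1,2) fac(3) _ fac(4) r(3)])
    then show "f \<in> \<F>" using f by (simp add: \<F>_def)
  qed
qed

lemma trivial_fibrations_eq: "\<F> \<inter> \<W> = rlp \<K> \<C>"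
proof
  show "\<F> \<inter> \<W> \<subseteq> rlp \<K> \<C>"
    using cofibration_lifts by (auto simp: rlp_def \<F>_def)
  show "rlp \<K> \<C> \<subseteq> \<F> \<inter> \<W>"
  proof
    fix f assume "f \<in> rlp \<K> \<C>"
    then have f: "f \<in> Arr \<K>" and l: "\<And>i. i \<in> \<C> \<Longrightarrow> lifts \<K> i f" by (auto simp: rlp_def)
    have F: "is_functor f (FDom f) (FCod f)" using f by (auto simp: \<K>_Arr)
    note I = is_functor_id[OF functor_cats(2)[OF F]]
    obtain E i p where fac: "E \<in> S" "is_functor i (FDom f) E" "is_functor p E (FCod f)"
      "p \<circ>\<^sub>F i = f" "i \<in> \<C>" "p \<in> \<F> \<inter> \<W>" by (rule cofibration_trivial_fibration_factorisation[OF f])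
    obtain r where r: "is_functor r E (FDom f)" "r \<circ>\<^sub>F i = id_functor (FDom f)" "f \<circ>\<^sub>F r = p"
      by (rule rlp_retract[OF f fac(1-4) l[OF fac(5)]])
    have pw: "iso_fibration p" "equivalence p" using fac(6) by (simp_all add: \<F>_def \<W>_def)
    have "iso_fibration f"
      by (rule iso_fibration_retract[OF F fac(2) r(1,2) fac(3) pw(1) fac(4) r(3)])
    moreover have "equivalence f"
    proof (rule equivalence_retract[OF F fac(3) pw(2) fac(2) r(1,2) I I comp_id(1)[OF I]])
      show "p \<circ>\<^sub>F i = id_functor (FCod f) \<circ>\<^sub>F f" using fac(4) comp_id(2)[OF F] by simp
      show "f \<circ>\<^sub>F r = id_functor (FCod f) \<circ>\<^sub>F p" using r(3) comp_id(2)[OF fac(3)] by simp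
    qed
    ultimately show "f \<in> \<F> \<inter> \<W>" using f by (simp add: \<F>_def \<W>_def)
  qed
qed

lemma cofibrations_eq: "\<C> = llp \<K> (\<F> \<inter> \<W>)"
proof
  show "\<C> \<subseteq> llp \<K> (\<F> \<inter> \<W>)"
    using cofibration_lifts by (auto simp: llp_def \<C>_def)
  show "llp \<K> (\<F> \<inter> \<W>) \<subseteq> \<C>"
  proof
    fix f assume "f \<in> llp \<K> (\<F> \<inter> \<W>)"
    then have f: "f \<in> Arr \<K>" and l: "\<And>p. p \<in> \<F> \<inter> \<W> \<Longrightarrow> lifts \<K> f p" by (auto simp: llp_def)
    have F: "is_functor f (FDom f) (FCod f)" using f by (auto simp: \<K>_Arr)
    obtain E i p where fac: "E \<in> S" "is_functor i (FDom f) E" "is_functor p E (FCod f)"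
      "p \<circ>\<^sub>F i = f" "i \<in> \<C>" "p \<in> \<F> \<inter> \<W>" by (rule cofibration_trivial_fibration_factorisation[OF f])
    obtain s where s: "is_functor s (FCod f) E" "s \<circ>\<^sub>F f = i" "p \<circ>\<^sub>F s = id_functor (FCod f)"
      by (rule llp_retract[OF f fac(1-4) l[OF fac(6)]])
    show "f \<in> \<C>"
      using inj_cancel[OF F s(2)] fac(5) f by (simp add: \<C>_alt functor_simps[OF fac(2)])
  qed
qed

lemma trivial_cofibrations_eq: "\<C> \<inter> \<W> = llp \<K> \<F>"
proof
  show "\<C> \<inter> \<W> \<subseteq> llp \<K> \<F>"
    using trivial_cofibration_lifts by (auto simp: llp_def \<C>_def)
  show "llp \<K> \<F> \<subseteq> \<C> \<inter> \<W>"
  proof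
    fix f assume "f \<in> llp \<K> \<F>"
    then have f: "f \<in> Arr \<K>" and l: "\<And>p. p \<in> \<F> \<Longrightarrow> lifts \<K> f p" by (auto simp: llp_def)
    have F: "is_functor f (FDom f) (FCod f)" using f by (auto simp: \<K>_Arr)
    note I = is_functor_id[OF functor_cats(1)[OF F]]
    obtain E i p where fac: "E \<in> S" "is_functor i (FDom f) E" "is_functor p E (FCod f)"
      "p \<circ>\<^sub>F i = f" "i \<in> \<C> \<inter> \<W>" "p \<in> \<F>" by (rule trivial_cofibration_fibration_factorisation[OF f])
    obtain s where s: "is_functor s (FCod f) E" "s \<circ>\<^sub>F f = i" "p \<circ>\<^sub>F s = id_functor (FCod f)"
      by (rule llp_retract[OF f fac(1-4) l[OF fac(6)]])
    have ie: "equivalence i" using fac(5) by (simp add: \<W>_def)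
    have "equivalence f"
    proof (rule equivalence_retract[OF F fac(2) ie I I comp_id(1)[OF I] s(1) fac(3) s(3)])
      show "i \<circ>\<^sub>F id_functor (FDom f) = s \<circ>\<^sub>F f" using s(2) comp_id(1)[OF fac(2)] by simp
      show "f \<circ>\<^sub>F id_functor (FDom f) = p \<circ>\<^sub>F i" using fac(4) comp_id(1)[OF F] by simp
    qed
    then show "f \<in> \<C> \<inter> \<W>"
      using inj_cancel[OF F s(2)] fac(5) f by (simp add: \<C>_alt \<W>_def functor_simps[OF fac(2)])
  qed
qed

lemma model_structure_\<K>: "model_structure \<K> \<W> \<F> \<C>"
  unfolding model_structure_def
proof (intro conjI)
  show "two_out_of_three \<K> \<W>"
    unfolding two_out_of_three_def
  proof (intro ballI impI)
    fix f g assume f: "f \<in> Arr \<K>" and g: "g \<in> Arr \<K>" and fg: "Cod \<K> f = Dom \<K> g"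
    have gf: "Cmp \<K> g f \<in> Arr \<K>" by (rule category_simps(6)[OF category_\<K> f g fg])
    have F: "is_functor f (FDom f) (FCod f)" and G: "is_functor g (FCod f) (FCod g)"
      using f g fg by (simp_all add: \<K>_Arr \<K>_simps)
    show "(f \<in> \<W> \<and> g \<in> \<W> \<longrightarrow> Cmp \<K> g f \<in> \<W>) \<and> (f \<in> \<W> \<and> Cmp \<K> g f \<in> \<W> \<longrightarrow> g \<in> \<W>) \<and>
      (g \<in> \<W> \<and> Cmp \<K> g f \<in> \<W> \<longrightarrow> f \<in> \<W>)"
      using equivalence_comp[OF F G] f g gf unfolding \<W>_def \<K>_simps by blast
  qed
  show "factorises \<K> \<C> (\<F> \<inter> \<W>)"
    unfolding factorises_def \<K>_simps
  proof
    fix f assume f: "f \<in> Arr \<K>"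
    obtain E i p where fac: "E \<in> S" "is_functor i (FDom f) E" "is_functor p E (FCod f)"
      "p \<circ>\<^sub>F i = f" "i \<in> \<C>" "p \<in> \<F> \<inter> \<W>" by (rule cofibration_trivial_fibration_factorisation[OF f])
    have "FCod i = FDom p" by (simp add: functor_simps(2)[OF fac(2)] functor_simps(1)[OF fac(3)])
    then show "\<exists>i\<in>\<C>. \<exists>p\<in>\<F> \<inter> \<W>. FCod i = FDom p \<and> p \<circ>\<^sub>F i = f" using fac(4-6) by blast
  qed
  show "factorises \<K> (\<C> \<inter> \<W>) \<F>"
    unfolding factorises_def \<K>_simps
  proof
    fix f assume f: "f \<in> Arr \<K>"
    obtain E i p where fac: "E \<in> S" "is_functor i (FDom f) E" "is_functor p E (FCod f)"
      "p \<circ>\<^sub>F i = f" "i \<in> \<C> \<inter> \<W>" "p \<in> \<F>" by (rule trivial_cofibration_fibration_factorisation[OF f])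
    have "FCod i = FDom p" by (simp add: functor_simps(2)[OF fac(2)] functor_simps(1)[OF fac(3)])
    then show "\<exists>i\<in>\<C> \<inter> \<W>. \<exists>p\<in>\<F>. FCod i = FDom p \<and> p \<circ>\<^sub>F i = f" using fac(4-6) by blast
  qed
  show "\<W> \<subseteq> Arr \<K>" "\<F> \<subseteq> Arr \<K>" "\<C> \<subseteq> Arr \<K>" by (simp_all add: \<W>_def \<F>_def \<C>_def)
qed (fact category_\<K> fibrations_eq trivial_fibrations_eq cofibrations_eq trivial_cofibrations_eq)+

end

theorem mainTheorem5:
  fixes \<kappa> :: "'k rel" and K :: "('u smallcat, 'u smallfunc) cat"
  assumes "infinite (UNIV :: 'u set)"
    and "Cinfinite \<kappa>"
    and "K = Cat \<kappa> \<or> K = Grpd \<kappa>"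
  shows "model_structure K
           {F \<in> Arr K. equivalence F}
           {F \<in> Arr K. iso_fibration F}
           {F \<in> Arr K. normally_cloven_iso_cofibration K F}"
  using assms(3)
proof
  assume K: "K = Cat \<kappa>"
  interpret reindexing_closed \<kappa> "{A :: 'u smallcat. category A \<and> small \<kappa> A}"
    by unfold_locales
      (use assms(1,2) in \<open>auto intro: category_reindexed small_reindexed\<close>)
  show ?thesis using model_structure_\<K> by (simp only: K Cat_def \<W>_def \<F>_def \<C>_def)
next
  assume K: "K = Grpd \<kappa>"
  interpret reindexing_closed \<kappa> "{A :: 'u smallcat. groupoid A \<and> small \<kappa> A}"
  proof unfold_locales
    fix A :: "'u smallcat" and e :: "'u \<times> 'u \<times> 'u \<Rightarrow> 'u" and T :: "'u set" and \<phi>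
    assume "A \<in> {A. groupoid A \<and> small \<kappa> A}" "inj e" "\<And>t. t \<in> T \<Longrightarrow> \<phi> t \<in> Obj A"
      "(card_of T, \<kappa>) \<in> ordLess"
    then show "reindexed e T \<phi> A \<in> {A. groupoid A \<and> small \<kappa> A}"
      using groupoid_reindexed[of e A T \<phi>] small_reindexed[OF assms(2)] by blast
  qed (use assms(1,2) in \<open>auto simp: groupoid_def\<close>)
  show ?thesis using model_structure_\<K> by (simp only: K Grpd_def \<W>_def \<F>_def \<C>_def)
qed

end
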